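(* Consider the dispersionless Lax system $[L_0,L_1]\in\operatorname{span}\{L_0,L_1\}$ for half-flat Cayley structures, regarded as a system of second order PDEs for the five functions $P,S,Q,T,E$ of $(x^0,x^1,x^2,x^3)$ as in the context. The symbol of its linearization along the trivial solution $P=S=Q=T=E=0$ is given by the following $5\times6$ matrix (rows corresponding, in order, to $P,S,Q,T,E$; $p=(p_0,p_1,p_2,p_3)$ are the coordinates of a covector $p=p_i\,\mathrm dx^i$): $$\sigma(p)=\begin{pmatrix} p_3^2&2p_2p_3&p_1p_3+p_2^2&p_1p_2+\frac13p_0p_3&\frac29p_1^2+\frac13p_0p_2&\frac19p_0p_1\\ p_1p_3&p_0p_3+p_1p_2&p_0p_2+\frac23p_1^2&p_0p_1&\frac13p_0^2&0\\ p_1p_3&p_0p_3+p_1p_2&p_0p_2+\frac13p_1^2&\frac13p_0p_1&0&0\\ p_1^2&2p_0p_1&p_0^2&0&0&0\\ 0&\frac23p_1p_3&\frac23p_0p_3+\frac23p_1p_2&\frac23p_0p_2+\frac13p_1^2&\frac49p_0p_1&\frac19p_0^2 \end{pmatrix}.$$ The matrix $\sigma(p)$ has rank less than or equal to 4 if and only if $$\tfrac13p_1^3+p_0^2p_3-p_0p_1p_2=0,$$ which is the dual variety of the ruled Cayley cubic $\frac13(y^2)^3+y^0(y^3)^2-y^1y^2y^3=0$, which defines a Cayley structure with respect to the normal-form coordinate system $(x^0,x^1,x^2,x^3)$ described in the context.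
   Context: A Cayley structure on a 4-manifold $M$ is a field of cones in the tangent spaces, each projectively equivalent to the ruled Cayley cubic $\frac13(y^2)^3+y^0(y^3)^2-y^1y^2y^3=0$; equivalently, it is the conformal class of a symmetric cubic form $\rho=\frac13(\omega^2)^3+\omega^0\omega^3\omega^3-\omega^1\omega^2\omega^3$ for a coframe $(\omega^0,\dots,\omega^3)$. It is half-flat if there is a 3-parameter family of surfaces in $M$ such that through each point and tangent to each ruling plane of the cone at that point there passes a unique member of the family. Normal-form coordinates: for every half-flat Cayley structure there are local coordinates $(x^0,x^1,x^2,x^3)$ and functions $E,F^1,F^2$ such that $$\omega^0=\mathrm dx^0,\quad \omega^1=\mathrm dx^1-(\partial_1F^2\,\mathrm dx^0+\partial_3F^2\,\mathrm dx^2),\quad \omega^2=\mathrm dx^2-E\,\mathrm dx^0,$$ $$\omega^3=\mathrm dx^3-E\,\mathrm dx^1-(\partial_1F^1\,\mathrm dx^0+\partial_3F^1\,\mathrm dx^2)+E(\partial_1F^2\,\mathrm dx^0+\partial_3F^2\,\mathrm dx^2),$$ where $\partial_i=\partial/\partial x^i$. Here $(y^0,\dots,y^3)$ are fibre coordinates on $TM$; for the trivial solution the coframe is $\omega^i=\mathrm dx^i$. Put $K_1=\partial_1+E\partial_3$, $P=K_1(F^1)$, $Q=K_1(F^2)$, $S=\partial_3F^1$, $T=\partial_3F^2$. The ruling planes are spanned by $$K_\lambda=(\partial_1+E\partial_3)+\lambda(\partial_0+E\partial_2+P\partial_3+Q\partial_1),\qquad R_\lambda=\partial_3+\lambda(\partial_2+S\partial_3+T\partial_1)+\tfrac13\lambda^2(\partial_1+E\partial_3).$$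 The Lax pair consists of the vector fields $L_0=K_\lambda+m(\lambda)\partial_\lambda$, $L_1=R_\lambda+n(\lambda)\partial_\lambda$ in the variables $(x,\lambda)$, where $m,n$ are the functions uniquely determined by $[L_0,L_1]\in\operatorname{span}\{L_0,L_1,\partial_\lambda\}$; they are polynomial in $\lambda$ and involve first derivatives of $P,S,Q,T,E$. The condition $[L_0,L_1]\in\operatorname{span}\{L_0,L_1\}$ expresses half-flatness; it amounts to the vanishing of the $\partial_\lambda$-component of $[L_0,L_1]$ relative to $L_0,L_1,\partial_\lambda$, which is polynomial in $\lambda$, and the coefficients of the powers of $\lambda$ give the PDE system. Written in terms of $P,S,Q,T,E$ (instead of $F^1,F^2,E$) and regarded as a system for these five functions, it is of second order. The symbol is formed from the second order terms of the linearized system, with $\partial_i\partial_j$ replaced by $p_ip_j$; rows correspond to unknown functions and columns to consecutive powers of $\lambda$ for which second order terms occur.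
   Formalization: In the symbol the rows for S, T, E carry the opposite sign to the printed matrix (ranks agree). The equivalence is stated for (p_0,p_2)≠(0,0); when p_0=p_2=0 the rank is always ≤4, so "only if" fails there, e.g. at p=(0,1,0,0), where the cubic is 1/3. *)

theory Defs
  imports "HOL-Analysis.Analysis" "HOL-Computational_Algebra.Polynomial"
begin

(* Coordinates and covectors are indexed by 0, 1, 2, 3 :: 4 (in this type 0 = 4).
   The components 1, ..., 5 :: 5 of an unknown are, in this order, P, S, Q, T, E. *)

section \<open>Partial derivatives, smoothness, Lie brackets\<close>

definition pderivative :: "4 \<Rightarrow> (real^4 \<Rightarrow> real) \<Rightarrow> real^4 \<Rightarrow> real" where
  "pderivative i f x = frechet_derivative f (at x) (axis i 1)"

definition smooth_fun :: "(real^4 \<Rightarrow> real) \<Rightarrow> bool" where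
  "smooth_fun f \<longleftrightarrow> (\<forall>is. foldr pderivative is f differentiable_on UNIV)"

definition smooth_map :: "(real^4 \<Rightarrow> real^'n) \<Rightarrow> bool" where
  "smooth_map f \<longleftrightarrow> (\<forall>i. smooth_fun (\<lambda>x. f x $ i))"

definition lie_bracket ::
  "('v \<Rightarrow> 'v) \<Rightarrow> ('v \<Rightarrow> 'v) \<Rightarrow> 'v \<Rightarrow> 'v::real_normed_vector" where
  "lie_bracket X Y z =
     frechet_derivative Y (at z) (X z) - frechet_derivative X (at z) (Y z)"

section \<open>Cayley structures and the normal form\<close>

definition cayley_cubic :: "real^4 \<Rightarrow> real" where
  "cayley_cubic y = 1/3 * (y$2)^3 + y$0 * (y$3)^2 - y$1 * y$2 * y$3"

text \<open>A coframe is given by \<open>\<omega> x y $ i\<close>, the value of the \<open>i\<close>-th 1-form at the point \<open>x\<close> on the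
  tangent vector \<open>y\<close>.\<close>

definition is_coframe :: "(real^4 \<Rightarrow> real^4 \<Rightarrow> real^4) \<Rightarrow> bool" where
  "is_coframe \<omega> \<longleftrightarrow> (\<forall>x. linear (\<omega> x) \<and> inj (\<omega> x)) \<and> (\<forall>y. smooth_map (\<lambda>x. \<omega> x y))"

text \<open>A real conformal factor of the cubic form can be absorbed into the coframe through its real
  cube root, so it does not appear explicitly.\<close>

definition cayley_structure :: "(real^4 \<Rightarrow> real^4 \<Rightarrow> real) \<Rightarrow> bool" where
  "cayley_structure \<rho> \<longleftrightarrow> (\<exists>\<omega>. is_coframe \<omega> \<and> (\<forall>x y. \<rho> x y = cayley_cubic (\<omega> x y)))"

definition normal_coframe ::
  "(real^4 \<Rightarrow> real) \<Rightarrow> (real^4 \<Rightarrow> real) \<Rightarrow> (real^4 \<Rightarrow> real) \<Rightarrow> real^4 \<Rightarrow> real^4 \<Rightarrow> real^4" where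
  "normal_coframe E F1 F2 x y = (\<chi> i.
     if i = 0 then y$0
     else if i = 1 then
       y$1 - (pderivative 1 F2 x * y$0 + pderivative 3 F2 x * y$2)
     else if i = 2 then
       y$2 - E x * y$0
     else
       y$3 - E x * y$1 - (pderivative 1 F1 x * y$0 + pderivative 3 F1 x * y$2)
         + E x * (pderivative 1 F2 x * y$0 + pderivative 3 F2 x * y$2))"

definition normal_form_unknowns ::
  "(real^4 \<Rightarrow> real) \<Rightarrow> (real^4 \<Rightarrow> real) \<Rightarrow> (real^4 \<Rightarrow> real) \<Rightarrow> real^4 \<Rightarrow> real^5" where
  "normal_form_unknowns E F1 F2 x = vector
     [pderivative 1 F1 x + E x * pderivative 3 F1 x, pderivative 3 F1 x,
      pderivative 1 F2 x + E x * pderivative 3 F2 x, pderivative 3 F2 x,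
      E x]"

section \<open>The Lax pair\<close>

text \<open>Vector fields in the variables \<open>(x, \<lambda>)\<close> are functions on \<^typ>\<open>(real^4) \<times> real\<close>.\<close>

definition K_field :: "(real^4 \<Rightarrow> real^5) \<Rightarrow> real \<Rightarrow> real^4 \<Rightarrow> real^4" where
  "K_field u l x = (let P = u x $ 1; S = u x $ 2; Q = u x $ 3; T = u x $ 4; E = u x $ 5 in
     (axis 1 1 + E *\<^sub>R axis 3 1)
     + l *\<^sub>R (axis 0 1 + E *\<^sub>R axis 2 1 + P *\<^sub>R axis 3 1 + Q *\<^sub>R axis 1 1))"

definition R_field :: "(real^4 \<Rightarrow> real^5) \<Rightarrow> real \<Rightarrow> real^4 \<Rightarrow> real^4" where
  "R_field u l x = (let P = u x $ 1; S = u x $ 2; Q = u x $ 3; T = u x $ 4; E = u x $ 5 in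
     axis 3 1 + l *\<^sub>R (axis 2 1 + S *\<^sub>R axis 3 1 + T *\<^sub>R axis 1 1)
     + (1/3 * l^2) *\<^sub>R (axis 1 1 + E *\<^sub>R axis 3 1))"

definition d_lambda :: "(real^4) \<times> real" where
  "d_lambda = (0, 1)"

definition L0 ::
  "(real^4 \<Rightarrow> real^5) \<Rightarrow> ((real^4) \<times> real \<Rightarrow> real) \<Rightarrow> (real^4) \<times> real \<Rightarrow> (real^4) \<times> real" where
  "L0 u m z = (K_field u (snd z) (fst z), 0) + m z *\<^sub>R d_lambda"

definition L1 ::
  "(real^4 \<Rightarrow> real^5) \<Rightarrow> ((real^4) \<times> real \<Rightarrow> real) \<Rightarrow> (real^4) \<times> real \<Rightarrow> (real^4) \<times> real" where
  "L1 u n z = (R_field u (snd z) (fst z), 0) + n z *\<^sub>R d_lambda"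

definition lax_normalized ::
  "(real^4 \<Rightarrow> real^5) \<Rightarrow> ((real^4) \<times> real \<Rightarrow> real) \<times> ((real^4) \<times> real \<Rightarrow> real) \<Rightarrow> bool" where
  "lax_normalized u = (\<lambda>(m, n).
     m differentiable_on UNIV \<and> n differentiable_on UNIV \<and>
     (\<forall>z. lie_bracket (L0 u m) (L1 u n) z \<in> span {L0 u m z, L1 u n z, d_lambda}))"

definition lax_mn ::
  "(real^4 \<Rightarrow> real^5) \<Rightarrow> ((real^4) \<times> real \<Rightarrow> real) \<times> ((real^4) \<times> real \<Rightarrow> real)" where
  "lax_mn u = (THE mn. lax_normalized u mn)"

definition lax_L0 :: "(real^4 \<Rightarrow> real^5) \<Rightarrow> (real^4) \<times> real \<Rightarrow> (real^4) \<times> real" where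
  "lax_L0 u = L0 u (fst (lax_mn u))"

definition lax_L1 :: "(real^4 \<Rightarrow> real^5) \<Rightarrow> (real^4) \<times> real \<Rightarrow> (real^4) \<times> real" where
  "lax_L1 u = L1 u (snd (lax_mn u))"

definition lax_condition :: "(real^4 \<Rightarrow> real^5) \<Rightarrow> bool" where
  "lax_condition u \<longleftrightarrow>
     (\<forall>z. lie_bracket (lax_L0 u) (lax_L1 u) z \<in> span {lax_L0 u z, lax_L1 u z})"

definition lax_component :: "(real^4 \<Rightarrow> real^5) \<Rightarrow> (real^4) \<times> real \<Rightarrow> real" where
  "lax_component u z = (THE c. \<exists>a b. lie_bracket (lax_L0 u) (lax_L1 u) z =
     a *\<^sub>R lax_L0 u z + b *\<^sub>R lax_L1 u z + c *\<^sub>R d_lambda)"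

definition lax_poly :: "(real^4 \<Rightarrow> real^5) \<Rightarrow> real^4 \<Rightarrow> real poly" where
  "lax_poly u x = (THE q. \<forall>l. poly q l = lax_component u (x, l))"

text \<open>The PDE system is \<open>lax_pde k u = 0\<close> for all \<open>k\<close>.\<close>

definition lax_pde :: "nat \<Rightarrow> (real^4 \<Rightarrow> real^5) \<Rightarrow> real^4 \<Rightarrow> real" where
  "lax_pde k u x = coeff (lax_poly u x) k"

section \<open>Linearization and symbol\<close>

definition is_linearization ::
  "((real^4 \<Rightarrow> real^5) \<Rightarrow> real^4 \<Rightarrow> real) \<Rightarrow> (real^4 \<Rightarrow> real^5)
    \<Rightarrow> ((real^4 \<Rightarrow> real^5) \<Rightarrow> real^4 \<Rightarrow> real) \<Rightarrow> bool" where
  "is_linearization G u D \<longleftrightarrow> (\<forall>v x. smooth_map v \<longrightarrow>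
     ((\<lambda>t. G (\<lambda>y. u y + t *\<^sub>R v y) x) has_real_derivative D v x) (at 0))"

definition has_second_order_symbol ::
  "((real^4 \<Rightarrow> real^5) \<Rightarrow> real^4 \<Rightarrow> real) \<Rightarrow> (real^4 \<Rightarrow> real^4 \<Rightarrow> real^5) \<Rightarrow> bool" where
  "has_second_order_symbol D s \<longleftrightarrow> (\<exists>a b c.
     (\<forall>v x. smooth_map v \<longrightarrow> D v x =
        (\<Sum>i\<in>UNIV. \<Sum>j\<in>UNIV. \<Sum>l\<in>UNIV.
           a x i j l * pderivative j (pderivative l (\<lambda>y. v y $ i)) x)
        + (\<Sum>i\<in>UNIV. \<Sum>j\<in>UNIV. b x i j * pderivative j (\<lambda>y. v y $ i) x)
        + (\<Sum>i\<in>UNIV. c x i * v x $ i)) \<and>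
     (\<forall>x p. s x p = (\<chi> i. \<Sum>j\<in>UNIV. \<Sum>l\<in>UNIV. a x i j l * p$j * p$l)))"

definition linearized_symbol ::
  "((real^4 \<Rightarrow> real^5) \<Rightarrow> real^4 \<Rightarrow> real) \<Rightarrow> (real^4 \<Rightarrow> real^5)
    \<Rightarrow> (real^4 \<Rightarrow> real^4 \<Rightarrow> real^5) \<Rightarrow> bool" where
  "linearized_symbol G u s \<longleftrightarrow> (\<exists>D. is_linearization G u D \<and> has_second_order_symbol D s)"

definition cayley_symbol :: "real^4 \<Rightarrow> real^6^5" where
  "cayley_symbol p = (let p0 = p$0; p1 = p$1; p2 = p$2; p3 = p$3 in vector
    [vector [p3^2, 2*p2*p3, p1*p3 + p2^2, p1*p2 + 1/3*p0*p3, 2/9*p1^2 + 1/3*p0*p2, 1/9*p0*p1],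
     vector [p1*p3, p0*p3 + p1*p2, p0*p2 + 2/3*p1^2, p0*p1, 1/3*p0^2, 0],
     vector [p1*p3, p0*p3 + p1*p2, p0*p2 + 1/3*p1^2, 1/3*p0*p1, 0, 0],
     vector [p1^2, 2*p0*p1, p0^2, 0, 0, 0],
     vector [0, 2/3*p1*p3, 2/3*p0*p3 + 2/3*p1*p2, 2/3*p0*p2 + 1/3*p1^2, 4/9*p0*p1, 1/9*p0^2]])"

text \<open>The matrix \<^const>\<open>cayley_symbol\<close> records the symbol for the unknowns \<open>P, -S, Q, -T, -E\<close>. With
  \<open>k = p1 + l p0\<close> and \<open>r = p3 + l p2 + l^2 p1 / 3\<close> (the symbols of \<open>K\<close> and \<open>R\<close> along the trivial
  solution), the rows of the symbol for \<open>P, S, Q, T, E\<close> are the coefficients of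
  \<open>l^2 r (r + l^2 k / 3)\<close>, \<open>- l^2 k (r + l^2 k / 3)\<close>, \<open>l^2 k r\<close>, \<open>- l^2 k^2\<close>,
  \<open>- l^3 k (2 r + l^2 k / 3) / 3\<close>. No change of basis of the columns removes the signs, because
  the entries of the first row are linearly independent.\<close>

definition row_sign :: "real^5" where
  "row_sign = vector [1, -1, 1, -1, -1]"

definition lax_symbol_matrix :: "real^4 \<Rightarrow> real^6^5" where
  "lax_symbol_matrix p = (\<chi> i j. row_sign $ i * cayley_symbol p $ i $ j)"

section \<open>The dual variety\<close>

definition dual_cubic :: "real^4 \<Rightarrow> real" where
  "dual_cubic p = 1/3 * (p$1)^3 + (p$0)^2 * p$3 - p$0 * p$1 * p$2"

text \<open>The rank also drops on the plane \<open>p$0 = p$2 = 0\<close>, which is not contained in the dual cubic: there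
  \<open>p$1\<close> times row 2 minus \<open>2 p$1\<close> times row 3 plus \<open>p$3\<close> times row 4 vanishes. The following lemma is an
  instance.\<close>

lemma rank_cayley_symbol_exceptional:
  "rank (cayley_symbol (axis 1 1)) \<le> 4" "dual_cubic (axis 1 1) \<noteq> 0"
proof -
  define A where "A = transpose (cayley_symbol (axis 1 1))"
  define v :: "real^5" where "v = axis 2 1 + (-2) *\<^sub>R axis 3 1"
  have "A *v v = column 2 A - 2 *\<^sub>R column 3 A"
    by (simp add: v_def matrix_vector_right_distrib matrix_vector_mult_scaleR
        matrix_vector_mult_basis matrix_vector_mult_diff_distrib)
  also have "\<dots> = 0"
    by (simp add: A_def vec_eq_iff row_def cayley_symbol_def Let_def vector_def axis_def)
  finally have "A *v v = 0" .
  moreover have "v $ 2 \<noteq> 0"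
    by (simp add: v_def axis_def)
  then have "v \<noteq> 0"
    by auto
  ultimately have "rank A \<noteq> CARD(5)"
    using matrix_nonfull_linear_equations_eq by blast
  moreover have "rank A \<le> 5"
    using rank_bound[of A] by simp
  ultimately show "rank (cayley_symbol (axis 1 1)) \<le> 4"
    by (simp add: A_def rank_transpose)
  show "dual_cubic (axis 1 1) \<noteq> 0"
    by (simp add: dual_cubic_def axis_def)
qed

definition zariski_closure :: "'v::real_normed_vector set \<Rightarrow> 'v set" where
  "zariski_closure A =
     {p. \<forall>q. real_polynomial_function q \<longrightarrow> (\<forall>s\<in>A. q s = 0) \<longrightarrow> q p = 0}"

text \<open>The affine cone over the projective dual: the closure of the set of covectors whose kernel is
  the tangent hyperplane of \<open>f = 0\<close> at some smooth point.\<close>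

definition dual_variety :: "(real^4 \<Rightarrow> real) \<Rightarrow> (real^4) set" where
  "dual_variety f = zariski_closure {p. \<exists>y c. f y = 0 \<and> frechet_derivative f (at y) \<noteq> (\<lambda>v. 0) \<and>
     c \<noteq> 0 \<and> (\<forall>v. p \<bullet> v = c * frechet_derivative f (at y) v)}"

end

theory Submission
  imports Defs
begin

text \<open>Write \<open>k = p1 + l p0\<close> and \<open>r = p3 + l p2 + l^2 p1 / 3\<close>. For \<open>p0 \<noteq> 0\<close> the rows of the symbol,
  read as polynomials in \<open>l\<close>, are linearly dependent iff \<open>k\<close> divides \<open>r\<close>, and
  \<open>p0^2 r(- p1 / p0)\<close> is the dual cubic.

  The fields \<open>K, \<partial>K/\<partial>\<lambda>, R, \<partial>R/\<partial>\<lambda>\<close> form a frame of determinant one up to sign, so \<open>m\<close> and \<open>n\<close> are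
  given by explicit formulas, polynomial in \<open>\<lambda>\<close>. Along a family \<open>t v\<close> the \<open>\<partial>\<^sub>\<lambda>\<close>-component of the
  bracket is \<open>t (K\<^sub>0 n\<^sub>1 - R\<^sub>0 m\<^sub>1) + O(t\<^sup>2)\<close>, where \<open>K\<^sub>0\<close>, \<open>R\<^sub>0\<close> belong to the trivial solution and
  \<open>m\<^sub>1\<close>, \<open>n\<^sub>1\<close> are the linear parts of \<open>m\<close>, \<open>n\<close>. Since everything is polynomial in \<open>t\<close> and \<open>\<lambda>\<close>, the
  coefficients of the powers of \<open>\<lambda>\<close> may be differentiated at \<open>t = 0\<close> separately.

  The gradient map of the cubic parametrizes the part \<open>p0 \<noteq> 0\<close> of the dual cubic, and the rest lies
  in its closure.\<close>

section \<open>Finite index types\<close>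

lemma four_eq_0: "(4::4) = 0" by simp
lemma UNIV_4': "UNIV = {0, 1, 2, 3 :: 4}"
proof -
  have "x \<in> {0, 1, 2, 3}" for x :: 4
    using exhaust_4[of x] unfolding four_eq_0 by blast
  then show ?thesis by blast
qed
lemma sum_4': "sum f (UNIV :: 4 set) = f 0 + f 1 + f 2 + f 3" for f :: "4 \<Rightarrow> 'a::comm_monoid_add"
proof -
  have "f 1 + f 2 + f 3 + f 4 = f 4 + f 1 + f 2 + f 3"
    by (simp only: ac_simps)
  then show ?thesis
    by (simp only: sum_4 four_eq_0)
qed

lemma forall_4': "(\<forall>i::4. P i) \<longleftrightarrow> P 0 \<and> P 1 \<and> P 2 \<and> P 3"
proof -
  have "(\<forall>i::4. P i) \<longleftrightarrow> (\<forall>i\<in>UNIV. P i)"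
    by simp
  then show ?thesis
    unfolding UNIV_4' by simp
qed

lemma vec_eq_iff_4: "x = y \<longleftrightarrow> x $ 0 = y $ 0 \<and> x $ 1 = y $ 1 \<and> x $ 2 = y $ 2 \<and> x $ 3 = y $ 3"
  for x y :: "'a^4"
  by (simp add: vec_eq_iff forall_4')

lemma exhaust_5: "x = 1 \<or> x = 2 \<or> x = 3 \<or> x = 4 \<or> x = 5" for x :: 5
proof (induct x)
  case (of_int z)
  then have "0 \<le> z" "z < 5" by simp_all
  then have "z = 0 \<or> z = 1 \<or> z = 2 \<or> z = 3 \<or> z = 4" by arith
  then show ?case by auto
qed

lemma exhaust_6: "x = 1 \<or> x = 2 \<or> x = 3 \<or> x = 4 \<or> x = 5 \<or> x = 6" for x :: 6
proof (induct x)
  case (of_int z)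
  then have "0 \<le> z" "z < 6" by simp_all
  then have "z = 0 \<or> z = 1 \<or> z = 2 \<or> z = 3 \<or> z = 4 \<or> z = 5" by arith
  then show ?case by auto
qed

lemma UNIV_5: "UNIV = {1, 2, 3, 4, 5 :: 5}"
  using exhaust_5 by auto

lemma UNIV_6: "UNIV = {1, 2, 3, 4, 5, 6 :: 6}"
  using exhaust_6 by auto

lemma forall_5: "(\<forall>i::5. P i) \<longleftrightarrow> P 1 \<and> P 2 \<and> P 3 \<and> P 4 \<and> P 5"
proof -
  have "(\<forall>i::5. P i) \<longleftrightarrow> (\<forall>i\<in>UNIV. P i)"
    by simp
  then show ?thesis
    unfolding UNIV_5 by simp
qed

lemma forall_6: "(\<forall>i::6. P i) \<longleftrightarrow> P 1 \<and> P 2 \<and> P 3 \<and> P 4 \<and> P 5 \<and> P 6"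
proof -
  have "(\<forall>i::6. P i) \<longleftrightarrow> (\<forall>i\<in>UNIV. P i)"
    by simp
  then show ?thesis
    unfolding UNIV_6 by simp
qed

lemma sum_5: "sum f (UNIV :: 5 set) = f 1 + f 2 + f 3 + f 4 + f 5"
  for f :: "5 \<Rightarrow> 'a::comm_monoid_add"
  unfolding UNIV_5 by (simp add: add.assoc)

lemma vector_5:
  "(vector [a, b, c, d, e] :: 'a::zero^5) $ 1 = a"
  "(vector [a, b, c, d, e] :: 'a^5) $ 2 = b"
  "(vector [a, b, c, d, e] :: 'a^5) $ 3 = c"
  "(vector [a, b, c, d, e] :: 'a^5) $ 4 = d"
  "(vector [a, b, c, d, e] :: 'a^5) $ 5 = e"
  by (simp_all add: vector_def)

lemma vector_6:
  "(vector [a, b, c, d, e, f] :: 'a::zero^6) $ 1 = a"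
  "(vector [a, b, c, d, e, f] :: 'a^6) $ 2 = b"
  "(vector [a, b, c, d, e, f] :: 'a^6) $ 3 = c"
  "(vector [a, b, c, d, e, f] :: 'a^6) $ 4 = d"
  "(vector [a, b, c, d, e, f] :: 'a^6) $ 5 = e"
  "(vector [a, b, c, d, e, f] :: 'a^6) $ 6 = f"
  by (simp_all add: vector_def)

section \<open>The rank of the symbol\<close>

text \<open>Row dependence is column dependence of the transpose, so the criterion for a nontrivial
  kernel is applied to \<open>transpose A\<close>.\<close>

lemma rank_less_iff_left_kernel:
  fixes A :: "real^'n^'m"
  shows "rank A < CARD('m) \<longleftrightarrow> (\<exists>x. x \<noteq> 0 \<and> x v* A = 0)"
proof -
  have "rank A \<le> CARD('m)"
    using rank_bound[of A] by simp
  moreover have "(\<exists>x. x \<noteq> 0 \<and> x v* A = 0) \<longleftrightarrow> rank A \<noteq> CARD('m)"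
    using matrix_nonfull_linear_equations_eq[of "transpose A"]
    by (simp add: rank_transpose)
  ultimately show ?thesis
    by auto
qed

text \<open>The six equations belong to the powers \<open>l^2\<close>, ..., \<open>l^7\<close> in
  turn; the rank arguments below work with these scalar equations.\<close>

lemma vector_cayley_symbol_eq_0_iff:
  "x v* cayley_symbol p = 0 \<longleftrightarrow>
     x$1 * (p$3)^2 + x$2 * (p$1 * p$3) + x$3 * (p$1 * p$3) + x$4 * (p$1)^2 = 0 \<and>
     x$1 * (2 * p$2 * p$3) + x$2 * (p$0 * p$3 + p$1 * p$2) + x$3 * (p$0 * p$3 + p$1 * p$2)
       + x$4 * (2 * p$0 * p$1) + x$5 * (2/3 * p$1 * p$3) = 0 \<and>
     x$1 * (p$1 * p$3 + (p$2)^2) + x$2 * (p$0 * p$2 + 2/3 * (p$1)^2)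
       + x$3 * (p$0 * p$2 + 1/3 * (p$1)^2) + x$4 * (p$0)^2
       + x$5 * (2/3 * p$0 * p$3 + 2/3 * p$1 * p$2) = 0 \<and>
     x$1 * (p$1 * p$2 + 1/3 * p$0 * p$3) + x$2 * (p$0 * p$1) + x$3 * (1/3 * p$0 * p$1)
       + x$5 * (2/3 * p$0 * p$2 + 1/3 * (p$1)^2) = 0 \<and>
     x$1 * (2/9 * (p$1)^2 + 1/3 * p$0 * p$2) + x$2 * (1/3 * (p$0)^2)
       + x$5 * (4/9 * p$0 * p$1) = 0 \<and>
     x$1 * (1/9 * p$0 * p$1) + x$5 * (1/9 * (p$0)^2) = 0"
  by (simp add: vec_eq_iff forall_6 vector_matrix_mult_def sum_5 cayley_symbol_def Let_def
      vector_5 vector_6 mult.commute)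

lemma rank_cayley_symbol_le_4_iff:
  "rank (cayley_symbol p) \<le> 4 \<longleftrightarrow> (\<exists>x. x \<noteq> 0 \<and> x v* cayley_symbol p = 0)"
  using rank_less_iff_left_kernel[of "cayley_symbol p"] by (simp add: less_Suc_eq_le eval_nat_numeral)

lemma rank_cayley_symbol_le_4I:
  assumes "x v* cayley_symbol p = 0" "x $ i \<noteq> 0"
  shows "rank (cayley_symbol p) \<le> 4"
  using assms rank_cayley_symbol_le_4_iff by (metis zero_index)

text \<open>Here \<open>k = p1\<close> and \<open>r = p3 + l^2 p1 / 3\<close>, so the rows of
  \<open>S\<close>, \<open>Q\<close> and \<open>T\<close> lie in the plane spanned by
  \<open>l^2\<close> and \<open>l^4\<close> and are dependent.\<close>

lemma rank_cayley_symbol_plane: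
  assumes "p$0 = 0" "p$2 = 0"
  shows "rank (cayley_symbol p) \<le> 4"
proof (cases "p$1 = 0")
  case True
  show ?thesis
    by (rule rank_cayley_symbol_le_4I[of "axis 4 1" _ 4])
      (use assms True in \<open>simp_all add: vector_cayley_symbol_eq_0_iff axis_def\<close>)
next
  case False
  show ?thesis
    by (rule rank_cayley_symbol_le_4I[of "vector [0, p$1, - 2 * p$1, p$3, 0]" _ 2])
      (use assms False in
        \<open>simp_all add: vector_cayley_symbol_eq_0_iff vector_5 power2_eq_square algebra_simps\<close>)
qed

text \<open>If \<open>p$0 \<noteq> 0\<close>, the dual cubic vanishes iff the linear polynomial \<open>k\<close> divides \<open>r\<close>. With
  \<open>r = k (s0 + s1 l)\<close>, all five rows are divisible by \<open>k\<^sup>2\<close>, and the quotients have degree at most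
  three, hence are linearly dependent; the witness below is their relation.\<close>

lemma rank_cayley_symbol_dual_cubic:
  assumes p: "p$0 \<noteq> 0" and cub: "dual_cubic p = 0"
  shows "rank (cayley_symbol p) \<le> 4"
proof -
  \<comment> \<open>\<open>s1\<close> and \<open>s0\<close> match the coefficients of
    \<open>l^2\<close> and \<open>l\<close> in \<open>r = k (s0 + s1 l)\<close>; the constant
    coefficients then differ by the dual cubic divided by \<open>p0^2\<close>.\<close>
  define s1 where "s1 = p$1 / (3 * p$0)"
  define s0 where "s0 = (p$2 - p$1 * s1) / p$0"
  define b where "b = 3 * s1^2 - s0"
  have p1: "p$1 = 3 * p$0 * s1"
    using p by (simp add: s1_def)
  have p2: "p$2 = p$0 * s0 + 3 * p$0 * s1^2"
    using p by (simp add: s0_def p1 power2_eq_square)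
  have "(p$0)^2 * (p$3 - p$1 * s0) = dual_cubic p"
    unfolding dual_cubic_def p1 p2 by algebra
  then have p3: "p$3 = 3 * p$0 * s1 * s0"
    using p cub by (simp add: p1)
  show ?thesis
  \<comment> \<open>With \<open>s = s0 + s1 l\<close>, the rows divided by \<open>l^2 k^2\<close>
    are \<open>s (s + l^2 / 3)\<close>, \<open>s + l^2 / 3\<close>, \<open>s\<close>,
    \<open>1\<close> and \<open>l (2 s + l^2 / 3) / 3\<close>. The entry \<open>- 3 * s1\<close>
    cancels \<open>l^3\<close> and \<open>l\<close>, \<open>- (s0^2)\<close> the constant term, and
    \<open>b\<close> the remaining multiple of \<open>l^2\<close>.\<close>
  proof (rule rank_cayley_symbol_le_4I[of "vector [1, b, - b, - (s0^2), - 3 * s1]" _ 1])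
    show "(vector [1, b, - b, - (s0^2), - 3 * s1]) v* cayley_symbol p = 0"
      unfolding vector_cayley_symbol_eq_0_iff vector_5 p1 p2 p3 b_def
      by (simp add: power2_eq_square field_simps)
  qed (simp add: vector_5)
qed

text \<open>A relation between the rows is an identity in \<open>l\<close>; its coefficients are
  used one at a time to eliminate the entries of \<open>x\<close>.\<close>

lemma rank_cayley_symbol_dual_cubic_nonzero:
  assumes p: "p$0 \<noteq> 0 \<or> p$2 \<noteq> 0" and cub: "dual_cubic p \<noteq> 0"
  shows "\<not> rank (cayley_symbol p) \<le> 4"
proof
  assume "rank (cayley_symbol p) \<le> 4"
  then obtain x where x: "x \<noteq> 0" and eqs: "x v* cayley_symbol p = 0"
    using rank_cayley_symbol_le_4_iff by blast
  note eqs = eqs[unfolded vector_cayley_symbol_eq_0_iff]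
  have "x$1 = 0 \<and> x$2 = 0 \<and> x$3 = 0 \<and> x$4 = 0 \<and> x$5 = 0"
  proof (cases "p$0 = 0")
    case True
    then have "p$1 \<noteq> 0" "p$2 \<noteq> 0"
      using p cub by (auto simp: dual_cubic_def)
    then have "x$1 = 0"
      using eqs True by simp
    then have "x$5 = 0"
      using eqs True \<open>p$1 \<noteq> 0\<close> by simp
    \<comment> \<open>The powers \<open>l^3\<close> and \<open>l^4\<close> give two independent
      equations for \<open>x$2\<close> and \<open>x$3\<close>; the first one needs
      \<open>p$2 \<noteq> 0\<close>.\<close>
    have "x$2 + x$3 = 0"
    proof -
      have "(x$2 + x$3) * (p$1 * p$2) = 0"
        using eqs True \<open>x$1 = 0\<close> \<open>x$5 = 0\<close> by (simp add: algebra_simps)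
      then show ?thesis
        using \<open>p$1 \<noteq> 0\<close> \<open>p$2 \<noteq> 0\<close> by simp
    qed
    have "(2 * x$2 + x$3) * (p$1)^2 = 0"
      using eqs True \<open>x$1 = 0\<close> \<open>x$5 = 0\<close> by (simp add: algebra_simps)
    then have "2 * x$2 + x$3 = 0"
      using \<open>p$1 \<noteq> 0\<close> by simp
    then have "x$2 = 0" "x$3 = 0"
      using \<open>x$2 + x$3 = 0\<close> by linarith+
    then have "x$4 = 0"
      using eqs True \<open>x$1 = 0\<close> \<open>p$1 \<noteq> 0\<close> by simp
    then show ?thesis
      using \<open>x$1 = 0\<close> \<open>x$2 = 0\<close> \<open>x$3 = 0\<close> \<open>x$5 = 0\<close> by simp
  next
    case False
    text \<open>Evaluation at the zero \<open>- p$1 / p$0\<close> of \<open>k\<close> kills all rows but the first.\<close>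
    have "x$1 * (dual_cubic p)^2 = 0"
      using eqs unfolding dual_cubic_def by algebra
    then have "x$1 = 0"
      using cub by simp
    then have "x$5 = 0"
      using eqs False by simp
    then have "x$2 = 0"
      using eqs False \<open>x$1 = 0\<close> by simp
    \<comment> \<open>A nonzero \<open>x$3\<close> would force \<open>p$1 = 0\<close> through
      \<open>l^5\<close> and then \<open>p$3 = 0\<close> through \<open>l^3\<close>, and there the
      dual cubic vanishes.\<close>
    have "x$3 = 0"
    proof (rule ccontr)
      assume "x$3 \<noteq> 0"
      then have "p$1 = 0"
        using eqs False \<open>x$1 = 0\<close> \<open>x$5 = 0\<close> \<open>x$2 = 0\<close> by simp
      then have "p$3 = 0"
        using eqs False \<open>x$1 = 0\<close> \<open>x$5 = 0\<close> \<open>x$2 = 0\<close> \<open>x$3 \<noteq> 0\<close> by simp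
      then show False
        using cub \<open>p$1 = 0\<close> by (simp add: dual_cubic_def)
    qed
    then have "x$4 = 0"
      using eqs False \<open>x$1 = 0\<close> \<open>x$5 = 0\<close> \<open>x$2 = 0\<close> by simp
    then show ?thesis
      using \<open>x$1 = 0\<close> \<open>x$2 = 0\<close> \<open>x$3 = 0\<close> \<open>x$5 = 0\<close> by simp
  qed
  then show False
    using x by (simp add: vec_eq_iff forall_5)
qed

lemma rank_cayley_symbol_iff:
  assumes "p$0 \<noteq> 0 \<or> p$2 \<noteq> 0"
  shows "rank (cayley_symbol p) \<le> 4 \<longleftrightarrow> dual_cubic p = 0"
proof (cases "p$0 = 0 \<and> dual_cubic p = 0")
  case True
  then have "p$1 = 0"
    by (auto simp: dual_cubic_def)
  \<comment> \<open>Now \<open>k = 0\<close>, and with it the row \<open>l^2 k^2\<close> of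
    \<open>T\<close>.\<close>
  then have "rank (cayley_symbol p) \<le> 4"
    using True by (intro rank_cayley_symbol_le_4I[of "axis 4 1" _ 4])
      (simp_all add: vector_cayley_symbol_eq_0_iff axis_def)
  then show ?thesis
    using True by simp
next
  case False
  then show ?thesis
    using assms rank_cayley_symbol_dual_cubic rank_cayley_symbol_dual_cubic_nonzero by blast
qed

lemma rank_row_scaling_le:
  fixes M :: "real^'n^'m"
  shows "rank (\<chi> i j. c $ i * M $ i $ j) \<le> rank M"
proof -
  have "(\<chi> i j. c $ i * M $ i $ j) = (\<chi> i k. if i = k then c $ i else 0) ** M"
    by (simp add: vec_eq_iff matrix_matrix_mult_def if_distrib[of "\<lambda>a. a * _"] cong: if_cong)
  then show ?thesis
    by (simp add: rank_mul_le_right)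
qed

text \<open>The signs square to one, so each matrix is a row scaling of the other and the rank
  inequality applies both ways.\<close>

lemma rank_lax_symbol_matrix: "rank (lax_symbol_matrix p) = rank (cayley_symbol p)"
proof (rule antisym)
  have "row_sign $ i * (row_sign $ i * a) = a" for i a
    using exhaust_5[of i] by (auto simp: row_sign_def vector_5)
  then have eq: "cayley_symbol p = (\<chi> i j. row_sign $ i * lax_symbol_matrix p $ i $ j)"
    by (simp add: vec_eq_iff lax_symbol_matrix_def)
  show "rank (cayley_symbol p) \<le> rank (lax_symbol_matrix p)"
    by (subst eq) (rule rank_row_scaling_le)
qed (simp add: lax_symbol_matrix_def rank_row_scaling_le)

section \<open>The dual variety\<close>

lemma has_derivative_cayley_cubic:
  "(cayley_cubic has_derivative (\<lambda>v. (y$3)^2 * v$0 - y$2 * y$3 * v$1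
     + ((y$2)^2 - y$1 * y$3) * v$2 + (2 * y$0 * y$3 - y$1 * y$2) * v$3)) (at y)"
  unfolding cayley_cubic_def[abs_def]
  by (auto intro!: derivative_eq_intros bounded_linear_imp_has_derivative[OF bounded_linear_vec_nth]
      simp: fun_eq_iff power2_eq_square algebra_simps)

definition cayley_gradient :: "real^4 \<Rightarrow> real^4" where
  "cayley_gradient y = (\<chi> i. if i = 0 then (y$3)^2 else if i = 1 then - y$2 * y$3
     else if i = 2 then (y$2)^2 - y$1 * y$3 else 2 * y$0 * y$3 - y$1 * y$2)"

lemma cayley_gradient_nth:
  "cayley_gradient y $ 0 = (y$3)^2"
  "cayley_gradient y $ 1 = - y$2 * y$3"
  "cayley_gradient y $ 2 = (y$2)^2 - y$1 * y$3"
  "cayley_gradient y $ 3 = 2 * y$0 * y$3 - y$1 * y$2"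
  by (simp_all add: cayley_gradient_def)

lemma frechet_derivative_cayley_cubic:
  "frechet_derivative cayley_cubic (at y) v = cayley_gradient y \<bullet> v"
proof -
  have "(cayley_cubic has_derivative (\<lambda>v. cayley_gradient y \<bullet> v)) (at y)"
    using has_derivative_cayley_cubic[of y]
    by (rule has_derivative_eq_rhs) (simp add: fun_eq_iff inner_vec_def sum_4' cayley_gradient_nth)
  then show ?thesis
    by (simp add: frechet_derivative_at[symmetric])
qed

text \<open>Replaces covectors by gradients, so that the dual variety becomes the closure of an
  explicitly parametrized set.\<close>

lemma dual_variety_cayley_cubic:
  "dual_variety cayley_cubic =
     zariski_closure {c *\<^sub>R cayley_gradient y | c y. cayley_cubic y = 0 \<and> cayley_gradient y \<noteq> 0 \<and> c \<noteq> 0}"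
proof -
  have "frechet_derivative cayley_cubic (at y) \<noteq> (\<lambda>v. 0) \<longleftrightarrow> cayley_gradient y \<noteq> 0" for y
    unfolding fun_eq_iff frechet_derivative_cayley_cubic
    using all_zero_iff[of "cayley_gradient y"] by (simp add: inner_commute)
  moreover have "(\<forall>v. p \<bullet> v = c * frechet_derivative cayley_cubic (at y) v) \<longleftrightarrow>
      p = c *\<^sub>R cayley_gradient y" for p y c
    using vector_eq_rdot[of p "c *\<^sub>R cayley_gradient y"]
    by (simp add: frechet_derivative_cayley_cubic)
  ultimately show ?thesis
    unfolding dual_variety_def by (intro arg_cong[of _ _ zariski_closure]) auto
qed

text \<open>An identity in \<open>y\<close>, used in both directions: zeros of the cubic yield zeros
  of the dual cubic, and conversely where \<open>c\<close> and \<open>y$3\<close> are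
  nonzero.\<close>

lemma dual_cubic_scaleR_cayley_gradient:
  "dual_cubic (c *\<^sub>R cayley_gradient y) = 2 * c^3 * (y$3)^3 * cayley_cubic y"
  unfolding dual_cubic_def cayley_cubic_def vector_scaleR_component cayley_gradient_nth real_scaleR_def
  by algebra

lemma real_polynomial_function_dual_cubic: "real_polynomial_function dual_cubic"
  unfolding dual_cubic_def[abs_def]
  by (intro real_polynomial_function.intros real_polynomial_function_diff
      real_polynomial_function_power bounded_linear_vec_nth)

text \<open>Normalizing \<open>y$3 = 1\<close> makes the first gradient entry 1, hence
  \<open>c = p$0\<close>; the other three entries then determine \<open>y2\<close>,
  \<open>y1\<close>, \<open>y0\<close> in turn.\<close>

lemma dual_cubic_in_image:
  assumes p: "p$0 \<noteq> 0" and cub: "dual_cubic p = 0"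
  shows "\<exists>c y. p = c *\<^sub>R cayley_gradient y \<and> cayley_cubic y = 0 \<and> cayley_gradient y \<noteq> 0 \<and> c \<noteq> 0"
proof -
  define y2 where "y2 = - p$1 / p$0"
  define y1 where "y1 = y2^2 - p$2 / p$0"
  define y0 where "y0 = (y1 * y2 + p$3 / p$0) / 2"
  define y :: "real^4" where
    "y = (\<chi> i. if i = 0 then y0 else if i = 1 then y1 else if i = 2 then y2 else 1)"
  have y: "y$0 = y0" "y$1 = y1" "y$2 = y2" "y$3 = 1"
    by (simp_all add: y_def)
  have eq: "p = p$0 *\<^sub>R cayley_gradient y"
    using p by (simp add: vec_eq_iff_4 cayley_gradient_nth y y2_def y1_def y0_def field_simps)
  moreover have "cayley_cubic y = 0"
    using dual_cubic_scaleR_cayley_gradient[of "p$0" y] cub p eq y by simp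
  moreover have "cayley_gradient y \<noteq> 0"
    using p eq by (metis scaleR_zero_right zero_index)
  ultimately show ?thesis
    using p by blast
qed

text \<open>The curves are found by prescribing \<open>p$0\<close>, \<open>p$1\<close>, \<open>p$3\<close> and solving the cubic for \<open>p$2\<close>.\<close>

lemma dual_cubic_limit:
  assumes cub: "dual_cubic p = 0" and p: "p$0 = 0"
  obtains g :: "real \<Rightarrow> real^4" where "continuous (at 0) g" "g 0 = p"
    "\<And>s. s \<noteq> 0 \<Longrightarrow> dual_cubic (g s) = 0 \<and> g s $ 0 \<noteq> 0"
proof -
  have p1: "p$1 = 0"
    using assms by (simp add: dual_cubic_def)
  show ?thesis
  proof (cases "p$2 = 0")
    case False
    \<comment> \<open>With \<open>p1 = s\<close> and \<open>p0 = s^2 / (3 p2)\<close> the terms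
      \<open>p1^3 / 3\<close> and \<open>p0 p1 p2\<close> balance to leading order, so the solved
      coordinate tends to the given \<open>p$2\<close>.\<close>
    define g :: "real \<Rightarrow> real^4" where "g = (\<lambda>s. p + (s^2 / (3 * p$2)) *\<^sub>R axis 0 1 + s *\<^sub>R axis 1 1
      + (s * p$3 / (3 * p$2)) *\<^sub>R axis 2 1)"
    have g: "g s $ 0 = s^2 / (3 * p$2)" "g s $ 1 = s" "g s $ 2 = p$2 + s * p$3 / (3 * p$2)"
      "g s $ 3 = p$3" for s
      by (simp_all add: g_def axis_def p p1)
    show ?thesis
    proof (rule that[of g])
      show "continuous (at 0) g"
        unfolding g_def using False by (intro continuous_intros) auto
      show "g 0 = p"
        by (simp add: g_def)
      show "dual_cubic (g s) = 0 \<and> g s $ 0 \<noteq> 0" if "s \<noteq> 0" for s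
        using that False unfolding dual_cubic_def g
        by (simp add: field_simps power2_eq_square power3_eq_cube)
    qed
  next
    case True
    \<comment> \<open>The exponents 3 and 2 give both \<open>p1^3\<close> and \<open>p0^2 p3\<close>
      the order \<open>s^6\<close> against \<open>p0 p1 = s^5\<close>, so the solved coordinate is
      of order \<open>s\<close> and tends to zero.\<close>
    define g :: "real \<Rightarrow> real^4" where "g = (\<lambda>s. p + s^3 *\<^sub>R axis 0 1 + s^2 *\<^sub>R axis 1 1
      + (s * (1/3 + p$3)) *\<^sub>R axis 2 1)"
    have g: "g s $ 0 = s^3" "g s $ 1 = s^2" "g s $ 2 = s * (1/3 + p$3)" "g s $ 3 = p$3" for s
      by (simp_all add: g_def axis_def p p1 True)
    show ?thesis
    proof (rule that[of g])
      show "continuous (at 0) g"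
        unfolding g_def by (intro continuous_intros)
      show "g 0 = p"
        by (simp add: g_def)
      show "dual_cubic (g s) = 0 \<and> g s $ 0 \<noteq> 0" if "s \<noteq> 0" for s
      proof
        show "dual_cubic (g s) = 0"
          unfolding dual_cubic_def g by algebra
      qed (use that g in simp)
    qed
  qed
qed

text \<open>The dual cubic is itself a polynomial vanishing on the gradients, which gives one
  inclusion. Conversely, a polynomial vanishing on them vanishes on the zeros with
  \<open>p$0 \<noteq> 0\<close>, and by continuity on their limits.\<close>

lemma dual_cubic_eq_dual_variety: "{p. dual_cubic p = 0} = dual_variety cayley_cubic"
proof (intro equalityI subsetI)
  fix p
  assume "p \<in> dual_variety cayley_cubic"
  moreover have "dual_cubic (c *\<^sub>R cayley_gradient y) = 0" if "cayley_cubic y = 0" for c y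
    using that by (simp add: dual_cubic_scaleR_cayley_gradient)
  ultimately show "p \<in> {p. dual_cubic p = 0}"
    unfolding dual_variety_cayley_cubic zariski_closure_def
    using real_polynomial_function_dual_cubic by blast
next
  fix p
  assume p: "p \<in> {p. dual_cubic p = 0}"
  have "q p = 0" if q: "real_polynomial_function q" and
    zero: "\<And>c y. cayley_cubic y = 0 \<Longrightarrow> cayley_gradient y \<noteq> 0 \<Longrightarrow> c \<noteq> 0 \<Longrightarrow>
      q (c *\<^sub>R cayley_gradient y) = 0" for q
  proof (cases "p$0 = 0")
    case False
    then show ?thesis
      using dual_cubic_in_image[of p] p zero by auto
  next
    case True
    obtain g :: "real \<Rightarrow> real^4" where g: "continuous (at 0) g" "g 0 = p"
      "\<And>s. s \<noteq> 0 \<Longrightarrow> dual_cubic (g s) = 0 \<and> g s $ 0 \<noteq> 0"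
      using dual_cubic_limit[of p] True p by auto
    have "q (g s) = 0" if "s \<noteq> 0" for s
      using dual_cubic_in_image[of "g s"] g(3)[OF that] zero by auto
    then have "((\<lambda>s. q (g s)) \<longlongrightarrow> 0) (at 0)"
      by (intro tendsto_eventually) (auto simp: eventually_at_filter)
    moreover have "isCont q p"
      using q continuous_real_polymonial_function by blast
    then have "((\<lambda>s. q (g s)) \<longlongrightarrow> q p) (at 0)"
      using g(1,2) by (auto simp: continuous_within intro: isCont_tendsto_compose)
    ultimately show ?thesis
      using LIM_unique by blast
  qed
  then show "p \<in> dual_variety cayley_cubic"
    unfolding dual_variety_cayley_cubic zariski_closure_def by blast
qed

section \<open>Smooth functions and families\<close>

lemma smooth_fun_differentiable: "smooth_fun f \<Longrightarrow> f differentiable (at x)"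
  unfolding smooth_fun_def differentiable_on_def by (metis UNIV_I foldr.simps(1) id_apply)

lemma smooth_fun_pderivative: "smooth_fun f \<Longrightarrow> smooth_fun (pderivative i f)"
  unfolding smooth_fun_def
proof
  fix js
  assume "\<forall>is. foldr pderivative is f differentiable_on UNIV"
  \<comment> \<open>\<open>foldr\<close> applies the last entry first, so the extra derivative is
    appended at the end.\<close>
  then have "foldr pderivative (js @ [i]) f differentiable_on UNIV"
    by blast
  then show "foldr pderivative js (pderivative i f) differentiable_on UNIV"
    by simp
qed

lemma pderivative_const: "pderivative i (\<lambda>x. c) = (\<lambda>x. 0)"
  by (simp add: pderivative_def fun_eq_iff)

lemma smooth_fun_const: "smooth_fun (\<lambda>x. c)"
proof -
  have "\<exists>d. foldr pderivative is (\<lambda>x. c) = (\<lambda>x. d)" for "is"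
    by (induction "is") (auto simp: pderivative_const)
  then show ?thesis
    unfolding smooth_fun_def by (metis differentiable_on_const)
qed

lemma has_derivative_pderivative:
  assumes "f differentiable (at x)"
  shows "(f has_derivative (\<lambda>w. \<Sum>i\<in>UNIV. w $ i * pderivative i f x)) (at x)"
proof -
  have f: "(f has_derivative frechet_derivative f (at x)) (at x)"
    using assms frechet_derivative_works by blast
  then interpret linear "frechet_derivative f (at x)"
    by (rule has_derivative_linear)
  have "frechet_derivative f (at x) w = (\<Sum>i\<in>UNIV. w $ i * pderivative i f x)" for w
    by (subst basis_expansion[of w, symmetric])
      (simp add: sum scale pderivative_def scalar_mult_eq_scaleR)
  then show ?thesis
    by (intro has_derivative_eq_rhs[OF f]) (rule ext)
qed

lemma pderivativeI: "(f has_derivative f') (at x) \<Longrightarrow> pderivative i f x = f' (axis i 1)"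
  unfolding pderivative_def by (metis frechet_derivative_at)

lemma pderivative_scale:
  assumes "\<And>x. f differentiable (at x)"
  shows "pderivative i (\<lambda>y. t * f y) = (\<lambda>x. t * pderivative i f x)"
proof
  fix x
  have "((\<lambda>y. t * f y) has_derivative (\<lambda>w. t * frechet_derivative f (at x) w)) (at x)"
    using assms frechet_derivative_works by (auto intro!: derivative_eq_intros)
  then show "pderivative i (\<lambda>y. t * f y) x = t * pderivative i f x"
    using pderivativeI by (fastforce simp: pderivative_def)
qed

lemma smooth_fun_scale:
  assumes "smooth_fun f"
  shows "smooth_fun (\<lambda>y. t * f y)"
proof -
  have "foldr pderivative is (\<lambda>y. t * f y) = (\<lambda>y. t * foldr pderivative is f y)" for "is"
  proof (induction "is")
    case (Cons i js)
    have "foldr pderivative js f differentiable (at x)" for x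
      using assms unfolding smooth_fun_def differentiable_on_def by simp
    then show ?case
      using Cons pderivative_scale by simp
  qed simp
  then show ?thesis
    using assms unfolding smooth_fun_def differentiable_on_def by (auto intro!: derivative_intros)
qed

lemma smooth_map_scaleR: "smooth_map v \<Longrightarrow> smooth_map (\<lambda>y. t *\<^sub>R v y)"
  unfolding smooth_map_def by (simp add: smooth_fun_scale)

lemma smooth_map_nth: "smooth_map v \<Longrightarrow> smooth_fun (\<lambda>x. v x $ i)"
  unfolding smooth_map_def by blast

lemma smooth_map_const: "smooth_map (\<lambda>x. c)"
  unfolding smooth_map_def by (simp add: smooth_fun_const)

text \<open>Functions of \<open>z = (x, \<lambda>)\<close> depending on a parameter \<open>t\<close>. The class is closed under partial
  derivatives in \<open>z\<close>, and for fixed \<open>x\<close> its members are polynomials in \<open>t\<close> and \<open>\<lambda>\<close>.\<close>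

inductive poly_family :: "(real \<Rightarrow> (real^4) \<times> real \<Rightarrow> real) \<Rightarrow> bool" where
  smooth: "smooth_fun g \<Longrightarrow> poly_family (\<lambda>t z. g (fst z))"
| param: "poly_family (\<lambda>t z. t)"
| snd: "poly_family (\<lambda>t z. snd z)"
| add: "poly_family F \<Longrightarrow> poly_family G \<Longrightarrow> poly_family (\<lambda>t z. F t z + G t z)"
| mult: "poly_family F \<Longrightarrow> poly_family G \<Longrightarrow> poly_family (\<lambda>t z. F t z * G t z)"

lemma poly_family_const: "poly_family (\<lambda>t z. c)"
  using poly_family.smooth[OF smooth_fun_const] .

lemma poly_family_minus: "poly_family F \<Longrightarrow> poly_family (\<lambda>t z. - F t z)"
  using poly_family.mult[OF poly_family_const[of "-1"]] by simp

lemma poly_family_diff: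
  "poly_family F \<Longrightarrow> poly_family G \<Longrightarrow> poly_family (\<lambda>t z. F t z - G t z)"
  using poly_family.add[OF _ poly_family_minus] by simp

lemma poly_family_power: "poly_family F \<Longrightarrow> poly_family (\<lambda>t z. F t z ^ k)"
  by (induction k) (simp_all add: poly_family_const poly_family.mult)

lemma poly_family_divide: "poly_family F \<Longrightarrow> poly_family (\<lambda>t z. F t z / c)"
  using poly_family.mult[OF _ poly_family_const[of "inverse c"]] by (simp add: divide_inverse)

lemma poly_family_sum:
  assumes "finite A" "\<And>i. i \<in> A \<Longrightarrow> poly_family (F i)"
  shows "poly_family (\<lambda>t z. \<Sum>i\<in>A. F i t z)"
  using assms by (induction A rule: finite_induct) (simp_all add: poly_family_const poly_family.add)

lemmas poly_family_intros = poly_family.intros(2-5) poly_family_const poly_family_minus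
  poly_family_diff poly_family_power poly_family_divide

text \<open>The partial derivatives are exhibited as families because the bracket differentiates
  \<open>m\<close> and \<open>n\<close>, and the result must stay polynomial in \<open>t\<close> and
  \<open>\<lambda>\<close>.\<close>

lemma poly_family_derivative:
  assumes "poly_family F"
  shows "\<exists>G H. (\<forall>i. poly_family (G i)) \<and> poly_family H \<and>
    (\<forall>t z. (F t has_derivative (\<lambda>w. (\<Sum>i\<in>UNIV. fst w $ i * G i t z) + snd w * H t z)) (at z))"
  using assms
proof induction
  case (smooth g)
  have "((\<lambda>z. g (fst z)) has_derivative
      (\<lambda>w. (\<Sum>i\<in>UNIV. fst w $ i * pderivative i g (fst z)) + snd w * 0)) (at z)" for z :: "(real^4) \<times> real"
    using has_derivative_compose[OF has_derivative_fst[OF has_derivative_ident]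
        has_derivative_pderivative[OF smooth_fun_differentiable[OF smooth, of "fst z"]]]
    by simp
  then show ?case
    using smooth smooth_fun_pderivative poly_family.smooth poly_family_const
    by (intro exI[of _ "\<lambda>i t z. pderivative i g (fst z)"] exI[of _ "\<lambda>t z. 0"]) blast
next
  case param
  then show ?case
    using poly_family_const by (intro exI[of _ "\<lambda>i t z. 0"] exI[of _ "\<lambda>t z. 0"]) simp
next
  case snd
  then show ?case
    using poly_family_const
    by (intro exI[of _ "\<lambda>i t z. 0"] exI[of _ "\<lambda>t z. 1"]) (auto intro!: derivative_eq_intros)
next
  case (add F F')
  then obtain G H G' H' where
    "\<And>i. poly_family (G i)" "poly_family H" "\<And>i. poly_family (G' i)" "poly_family H'" and
    der: "\<And>t z. (F t has_derivative (\<lambda>w. (\<Sum>i\<in>UNIV. fst w $ i * G i t z) + snd w * H t z)) (at z)"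
      "\<And>t z. (F' t has_derivative (\<lambda>w. (\<Sum>i\<in>UNIV. fst w $ i * G' i t z) + snd w * H' t z)) (at z)"
    by blast
  then show ?case
    by (intro exI[of _ "\<lambda>i t z. G i t z + G' i t z"] exI[of _ "\<lambda>t z. H t z + H' t z"])
      (auto intro!: poly_family_intros derivative_eq_intros der
        simp: fun_eq_iff algebra_simps sum.distrib)
next
  case (mult F F')
  then obtain G H G' H' where
    "\<And>i. poly_family (G i)" "poly_family H" "\<And>i. poly_family (G' i)" "poly_family H'" and
    der: "\<And>t z. (F t has_derivative (\<lambda>w. (\<Sum>i\<in>UNIV. fst w $ i * G i t z) + snd w * H t z)) (at z)"
      "\<And>t z. (F' t has_derivative (\<lambda>w. (\<Sum>i\<in>UNIV. fst w $ i * G' i t z) + snd w * H' t z)) (at z)"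
    by blast
  then show ?case
    using mult.hyps
    by (intro exI[of _ "\<lambda>i t z. F t z * G' i t z + G i t z * F' t z"]
        exI[of _ "\<lambda>t z. F t z * H' t z + H t z * F' t z"])
      (auto intro!: poly_family_intros derivative_eq_intros der
        simp: fun_eq_iff algebra_simps sum.distrib sum_distrib_left sum_distrib_right)
qed

lemma poly_family_differentiable: "poly_family F \<Longrightarrow> F t differentiable (at z)"
  using poly_family_derivative unfolding differentiable_def by blast

lemma poly_family_frechet_derivative:
  assumes F: "poly_family F" and V: "\<And>i. poly_family (\<lambda>t z. V t z $ i)" and s: "poly_family s"
  shows "poly_family (\<lambda>t z. frechet_derivative (F t) (at z) (V t z, s t z))"
proof -
  obtain G H where GH: "\<And>i. poly_family (G i)" "poly_family H" and
    der: "\<And>t z. (F t has_derivative (\<lambda>w. (\<Sum>i\<in>UNIV. fst w $ i * G i t z) + snd w * H t z)) (at z)"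
    using poly_family_derivative[OF F] by blast
  have "frechet_derivative (F t) (at z) =
      (\<lambda>w. (\<Sum>i\<in>UNIV. fst w $ i * G i t z) + snd w * H t z)" for t z
    using frechet_derivative_at[OF der] by simp
  then show ?thesis
    using V s GH by (auto intro!: poly_family_intros poly_family_sum)
qed

text \<open>The outer variable of the bivariate polynomial is \<open>t\<close>, the inner one is \<open>\<lambda>\<close>.\<close>

lemma poly_family_poly:
  assumes "poly_family F"
  shows "\<exists>B. \<forall>t l. F t (x, l) = poly (poly B [:t:]) l"
  using assms
proof induction
  case (smooth g)
  show ?case
    by (intro exI[of _ "[:[:g x:]:]"]) simp
next
  case param
  show ?case
    by (intro exI[of _ "[:0, 1:]"]) simp
next
  case snd
  show ?case
    by (intro exI[of _ "[:[:0, 1:]:]"]) simp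
next
  case (add F G)
  then obtain B C where "\<forall>t l. F t (x, l) = poly (poly B [:t:]) l"
    "\<forall>t l. G t (x, l) = poly (poly C [:t:]) l"
    by blast
  then show ?case
    by (intro exI[of _ "B + C"]) simp
next
  case (mult F G)
  then obtain B C where "\<forall>t l. F t (x, l) = poly (poly B [:t:]) l"
    "\<forall>t l. G t (x, l) = poly (poly C [:t:]) l"
    by blast
  then show ?case
    by (intro exI[of _ "B * C"]) simp
qed

text \<open>Differentiation in \<open>t\<close> is the formal derivative in the outer variable, so
  it commutes with taking coefficients in \<open>\<lambda>\<close>.\<close>

lemma has_real_derivative_coeff_poly:
  fixes B :: "real poly poly"
  shows "((\<lambda>t. coeff (poly B [:t:]) k) has_real_derivative coeff (poly (pderiv B) [:t:]) k) (at t)"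
proof (induction B arbitrary: k)
  case (pCons a B)
  have "((\<lambda>t. coeff a k + t * coeff (poly B [:t:]) k) has_real_derivative
      coeff (poly B [:t:]) k + t * coeff (poly (pderiv B) [:t:]) k) (at t)"
    using pCons.IH[of k] by (auto intro!: derivative_eq_intros)
  then show ?case
    by (simp add: pderiv_pCons)
qed simp

lemma has_real_derivative_poly_poly:
  fixes B :: "real poly poly"
  shows "((\<lambda>t. poly (poly B [:t:]) l) has_real_derivative poly (poly (pderiv B) [:t:]) l) (at t)"
proof (induction B)
  case (pCons a B)
  have "((\<lambda>t. poly a l + t * poly (poly B [:t:]) l) has_real_derivative
      poly (poly B [:t:]) l + t * poly (poly (pderiv B) [:t:]) l) (at t)"
    using pCons.IH by (auto intro!: derivative_eq_intros)
  then show ?case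
    by (simp add: pderiv_pCons)
qed simp

section \<open>The Lax pair\<close>

lemma has_derivative_vec:
  fixes f :: "'a::real_normed_vector \<Rightarrow> real^'n"
  assumes "\<And>i. ((\<lambda>x. f x $ i) has_derivative (\<lambda>w. f' w $ i)) (at x)"
  shows "(f has_derivative f') (at x)"
  unfolding has_derivative_componentwise_within[of f]
  using assms by (auto simp: Basis_vec_def simp flip: cart_eq_inner_axis)

lemma K_field_nth:
  "K_field u l x $ 0 = l"
  "K_field u l x $ 1 = 1 + l * u x $ 3"
  "K_field u l x $ 2 = l * u x $ 5"
  "K_field u l x $ 3 = u x $ 5 + l * u x $ 1"
  by (simp_all add: K_field_def Let_def axis_def algebra_simps)

lemma R_field_nth:
  "R_field u l x $ 0 = 0"
  "R_field u l x $ 1 = l * u x $ 4 + l^2 / 3"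
  "R_field u l x $ 2 = l"
  "R_field u l x $ 3 = 1 + l * u x $ 2 + l^2 / 3 * u x $ 5"
  by (simp_all add: R_field_def Let_def axis_def algebra_simps)

definition K_der :: "(real^4 \<Rightarrow> real^5) \<Rightarrow> (real^4 \<Rightarrow> real) \<Rightarrow> (real^4) \<times> real \<Rightarrow> real" where
  "K_der u f z = (\<Sum>i\<in>UNIV. K_field u (snd z) (fst z) $ i * pderivative i f (fst z))"

definition R_der :: "(real^4 \<Rightarrow> real^5) \<Rightarrow> (real^4 \<Rightarrow> real) \<Rightarrow> (real^4) \<times> real \<Rightarrow> real" where
  "R_der u f z = (\<Sum>i\<in>UNIV. R_field u (snd z) (fst z) $ i * pderivative i f (fst z))"

text \<open>The components of \<open>[K, R]\<close>, where the bracket is taken in \<open>x\<close> with \<open>\<lambda>\<close> fixed.\<close>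

definition bracket1 :: "(real^4 \<Rightarrow> real^5) \<Rightarrow> (real^4) \<times> real \<Rightarrow> real" where
  "bracket1 u z = snd z * (K_der u (\<lambda>x. u x $ 4) z - R_der u (\<lambda>x. u x $ 3) z)"

definition bracket2 :: "(real^4 \<Rightarrow> real^5) \<Rightarrow> (real^4) \<times> real \<Rightarrow> real" where
  "bracket2 u z = - (snd z * R_der u (\<lambda>x. u x $ 5) z)"

definition bracket3 :: "(real^4 \<Rightarrow> real^5) \<Rightarrow> (real^4) \<times> real \<Rightarrow> real" where
  "bracket3 u z = snd z * K_der u (\<lambda>x. u x $ 2) z + (snd z)^2 / 3 * K_der u (\<lambda>x. u x $ 5) z
     - R_der u (\<lambda>x. u x $ 5) z - snd z * R_der u (\<lambda>x. u x $ 1) z"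

text \<open>With \<open>A = \<partial>K/\<partial>\<lambda>\<close> and \<open>B = \<partial>\<^sub>2 + S \<partial>\<^sub>3 + T \<partial>\<^sub>1\<close>, the fields \<open>A\<close>, \<open>B\<close>, \<open>K\<^sub>1\<close> and \<open>\<partial>\<^sub>3\<close> form a frame and
  \<open>K = K\<^sub>1 + \<lambda> A\<close>, \<open>R = \<partial>\<^sub>3 + \<lambda> B + \<lambda>\<^sup>2/3 K\<^sub>1\<close>. Solving \<open>[K, R] + m \<partial>R/\<partial>\<lambda> - n \<partial>K/\<partial>\<lambda> = a K + b R\<close> in this
  frame gives \<open>b\<close>, \<open>m\<close>, \<open>a\<close>, \<open>n\<close> one after the other.\<close>

definition lax_b :: "(real^4 \<Rightarrow> real^5) \<Rightarrow> (real^4) \<times> real \<Rightarrow> real" where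
  "lax_b u z = bracket3 u z - bracket2 u z * u (fst z) $ 2
     - u (fst z) $ 5 * (bracket1 u z - bracket2 u z * u (fst z) $ 4)"

definition lax_m :: "(real^4 \<Rightarrow> real^5) \<Rightarrow> (real^4) \<times> real \<Rightarrow> real" where
  "lax_m u z = snd z * lax_b u z - bracket2 u z"

definition lax_a :: "(real^4 \<Rightarrow> real^5) \<Rightarrow> (real^4) \<times> real \<Rightarrow> real" where
  "lax_a u z = bracket1 u z - bracket2 u z * u (fst z) $ 4 + 2/3 * snd z * lax_m u z
     - (snd z)^2 / 3 * lax_b u z"

definition lax_n :: "(real^4 \<Rightarrow> real^5) \<Rightarrow> (real^4) \<times> real \<Rightarrow> real" where
  "lax_n u z = - (snd z * lax_a u z)"

text \<open>The last component of the bracket, less the contributions \<open>a m\<close> and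
  \<open>b n\<close> of the two Lax fields.\<close>

definition lax_c :: "(real^4 \<Rightarrow> real^5) \<Rightarrow> (real^4) \<times> real \<Rightarrow> real" where
  "lax_c u z =
     frechet_derivative (lax_n u) (at z) (K_field u (snd z) (fst z), lax_m u z)
     - frechet_derivative (lax_m u) (at z) (R_field u (snd z) (fst z), lax_n u z)
     - lax_a u z * lax_m u z - lax_b u z * lax_n u z"

text \<open>The equations are the components 0 to 3 of the bracket relation. Inserting
  \<open>n = - l a\<close> cancels the terms of \<open>a\<close> with \<open>Q\<close>,
  \<open>E\<close> and \<open>P\<close>, which makes the system triangular.\<close>

lemma bracket_eq_iff:
  fixes a b m n V1 V2 V3 P S Q T E l :: real
  shows "- n = a * l \<and>
      V1 + m * (T + 2/3 * l) - n * Q = a * (1 + l * Q) + b * (l * T + l^2/3) \<and>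
      V2 + m - n * E = a * (l * E) + b * l \<and>
      V3 + m * (S + 2/3 * l * E) - n * P = a * (E + l * P) + b * (1 + l * S + l^2/3 * E) \<longleftrightarrow>
    b = V3 - V2 * S - E * (V1 - V2 * T) \<and> m = l * b - V2 \<and>
      a = V1 - V2 * T + 2/3 * l * m - l^2/3 * b \<and> n = - (l * a)" (is "?L \<longleftrightarrow> ?R")
proof
  assume ?L
  then have "- n = a * l"
    by simp
  then have n: "n = - (l * a)"
    by algebra
  from \<open>?L\<close> have "V2 + m - n * E = a * (l * E) + b * l"
    by simp
  then have m: "m = l * b - V2"
    unfolding n by (simp add: algebra_simps)
  from \<open>?L\<close> have "V1 + m * (T + 2/3 * l) - n * Q = a * (1 + l * Q) + b * (l * T + l^2/3)"
    by simp
  then have a: "a = V1 - V2 * T + 2/3 * l * m - l^2/3 * b"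
    unfolding n m by (simp add: algebra_simps power2_eq_square)
  from \<open>?L\<close> have "V3 + m * (S + 2/3 * l * E) - n * P = a * (E + l * P) + b * (1 + l * S + l^2/3 * E)"
    by simp
  then have "b = V3 - V2 * S - E * (V1 - V2 * T)"
    unfolding n m a by algebra
  then show ?R
    using n m a by simp
next
  assume R: ?R
  then have n: "n = - (l * a)" and m: "m = l * b - V2"
      and a: "a = V1 - V2 * T + 2/3 * l * m - l^2/3 * b"
      and V3: "V3 = b + V2 * S + E * (V1 - V2 * T)"
    by (auto simp: algebra_simps)
  show ?L
    unfolding V3 n a m by (simp add: field_simps power2_eq_square)
qed

context
  fixes u :: "real^4 \<Rightarrow> real^5"
  assumes u: "smooth_map u"
begin

lemma has_derivative_component:
  "((\<lambda>z. u (fst z) $ i) has_derivative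
     (\<lambda>w. \<Sum>j\<in>UNIV. fst w $ j * pderivative j (\<lambda>x. u x $ i) (fst z))) (at z)"
  for z :: "(real^4) \<times> real"
  using has_derivative_compose[OF has_derivative_fst[OF has_derivative_ident]
      has_derivative_pderivative[OF smooth_fun_differentiable[OF smooth_map_nth[OF u]]]] .

text \<open>Since \<open>K\<close> and \<open>R\<close> depend on \<open>\<lambda>\<close>, the
  \<open>\<lambda>\<close>-components of the Lax fields add \<open>m \<partial>R/\<partial>\<lambda>
  - n \<partial>K/\<partial>\<lambda>\<close> to the bracket taken at fixed
  \<open>\<lambda>\<close>.\<close>

lemma lie_bracket_Lax:
  assumes m: "m differentiable (at z)" and n: "n differentiable (at z)"
  defines "x \<equiv> fst z" and "l \<equiv> snd z" and "W \<equiv> lie_bracket (L0 u m) (L1 u n) z"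
  shows "fst W $ 0 = - n z"
    "fst W $ 1 = bracket1 u z + m z * (u x $ 4 + 2/3 * l) - n z * u x $ 3"
    "fst W $ 2 = bracket2 u z + m z - n z * u x $ 5"
    "fst W $ 3 = bracket3 u z + m z * (u x $ 2 + 2/3 * l * u x $ 5) - n z * u x $ 1"
    "snd W = frechet_derivative n (at z) (K_field u l x, m z)
       - frechet_derivative m (at z) (R_field u l x, n z)"
proof -
  define du where "du i w = (\<Sum>j\<in>UNIV. fst w $ j * pderivative j (\<lambda>x. u x $ i) x)"
    for i and w :: "(real^4) \<times> real"
  note der = has_derivative_component[of _ z, folded x_def, folded du_def]
    bounded_linear_imp_has_derivative[OF bounded_linear_snd]
  define dK :: "(real^4) \<times> real \<Rightarrow> real^4" where "dK w = (\<chi> i. if i = 0 then snd w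
    else if i = 1 then snd w * u x $ 3 + l * du 3 w
    else if i = 2 then snd w * u x $ 5 + l * du 5 w
    else du 5 w + snd w * u x $ 1 + l * du 1 w)" for w
  define dR :: "(real^4) \<times> real \<Rightarrow> real^4" where "dR w = (\<chi> i. if i = 0 then 0
    else if i = 1 then snd w * u x $ 4 + l * du 4 w + 2/3 * l * snd w
    else if i = 2 then snd w
    else snd w * u x $ 2 + l * du 2 w + 2/3 * l * snd w * u x $ 5 + l^2/3 * du 5 w)" for w
  have dK_nth: "dK w $ 0 = snd w" "dK w $ 1 = snd w * u x $ 3 + l * du 3 w"
    "dK w $ 2 = snd w * u x $ 5 + l * du 5 w"
    "dK w $ 3 = du 5 w + snd w * u x $ 1 + l * du 1 w" for w
    by (simp_all add: dK_def)
  have dR_nth: "dR w $ 0 = 0" "dR w $ 1 = snd w * u x $ 4 + l * du 4 w + 2/3 * l * snd w"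
    "dR w $ 2 = snd w"
    "dR w $ 3 = snd w * u x $ 2 + l * du 2 w + 2/3 * l * snd w * u x $ 5 + l^2/3 * du 5 w" for w
    by (simp_all add: dR_def)
  have "((\<lambda>z. K_field u (snd z) (fst z) $ i) has_derivative (\<lambda>w. dK w $ i)) (at z)" for i
  proof -
    have "\<forall>i. ((\<lambda>z. K_field u (snd z) (fst z) $ i) has_derivative (\<lambda>w. dK w $ i)) (at z)"
      unfolding forall_4' K_field_nth dK_nth
      by (auto intro!: derivative_eq_intros der simp: x_def l_def fun_eq_iff algebra_simps)
    then show ?thesis
      by blast
  qed
  then have K: "((\<lambda>z. K_field u (snd z) (fst z)) has_derivative dK) (at z)"
    by (rule has_derivative_vec)
  have "((\<lambda>z. R_field u (snd z) (fst z) $ i) has_derivative (\<lambda>w. dR w $ i)) (at z)" for i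
  proof -
    have "\<forall>i. ((\<lambda>z. R_field u (snd z) (fst z) $ i) has_derivative (\<lambda>w. dR w $ i)) (at z)"
      unfolding forall_4' R_field_nth dR_nth
      by (auto intro!: derivative_eq_intros der simp: x_def l_def fun_eq_iff algebra_simps)
    then show ?thesis
      by blast
  qed
  then have R: "((\<lambda>z. R_field u (snd z) (fst z)) has_derivative dR) (at z)"
    by (rule has_derivative_vec)
  have L0_eq: "L0 u m = (\<lambda>z. (K_field u (snd z) (fst z), m z))"
    by (simp add: L0_def d_lambda_def fun_eq_iff)
  have L1_eq: "L1 u n = (\<lambda>z. (R_field u (snd z) (fst z), n z))"
    by (simp add: L1_def d_lambda_def fun_eq_iff)
  have "(L0 u m has_derivative (\<lambda>w. (dK w, frechet_derivative m (at z) w))) (at z)"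
    unfolding L0_eq using m frechet_derivative_works[of m] by (auto intro: has_derivative_Pair[OF K])
  then have dL0: "frechet_derivative (L0 u m) (at z) = (\<lambda>w. (dK w, frechet_derivative m (at z) w))"
    by (rule frechet_derivative_at[symmetric])
  have "(L1 u n has_derivative (\<lambda>w. (dR w, frechet_derivative n (at z) w))) (at z)"
    unfolding L1_eq using n frechet_derivative_works[of n] by (auto intro: has_derivative_Pair[OF R])
  then have dL1: "frechet_derivative (L1 u n) (at z) = (\<lambda>w. (dR w, frechet_derivative n (at z) w))"
    by (rule frechet_derivative_at[symmetric])
  have W: "W = (dR (K_field u l x, m z) - dK (R_field u l x, n z),
      frechet_derivative n (at z) (K_field u l x, m z)
      - frechet_derivative m (at z) (R_field u l x, n z))"
    unfolding W_def lie_bracket_def dL0 dL1 unfolding L0_eq L1_eq by (simp add: x_def l_def)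
  \<comment> \<open>\<open>du\<close> ignores the \<open>\<lambda>\<close>-component, so
    \<open>s\<close> may be arbitrary.\<close>
  have duK: "du i (K_field u l x, s) = K_der u (\<lambda>x. u x $ i) z" for i s
    by (simp add: du_def K_der_def x_def l_def)
  have duR: "du i (R_field u l x, s) = R_der u (\<lambda>x. u x $ i) z" for i s
    by (simp add: du_def R_der_def x_def l_def)
  show "fst W $ 0 = - n z"
    "fst W $ 1 = bracket1 u z + m z * (u x $ 4 + 2/3 * l) - n z * u x $ 3"
    "fst W $ 2 = bracket2 u z + m z - n z * u x $ 5"
    "fst W $ 3 = bracket3 u z + m z * (u x $ 2 + 2/3 * l * u x $ 5) - n z * u x $ 1"
    unfolding W by (simp_all add: dK_nth dR_nth duK duR bracket1_def bracket2_def bracket3_def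
        algebra_simps flip: l_def)
  show "snd W = frechet_derivative n (at z) (K_field u l x, m z)
       - frechet_derivative m (at z) (R_field u l x, n z)"
    unfolding W by simp
qed

text \<open>A pointwise equivalence, which serves for the uniqueness of \<open>m\<close> and
  \<open>n\<close> as well as of the coefficients \<open>a\<close> and \<open>b\<close>.\<close>

lemma lie_bracket_Lax_horizontal_iff:
  assumes m: "m differentiable (at z)" and n: "n differentiable (at z)"
  shows "fst (lie_bracket (L0 u m) (L1 u n) z) =
      a *\<^sub>R K_field u (snd z) (fst z) + b *\<^sub>R R_field u (snd z) (fst z) \<longleftrightarrow>
    a = lax_a u z \<and> b = lax_b u z \<and> m z = lax_m u z \<and> n z = lax_n u z"
proof -
  have "fst (lie_bracket (L0 u m) (L1 u n) z) =
      a *\<^sub>R K_field u (snd z) (fst z) + b *\<^sub>R R_field u (snd z) (fst z) \<longleftrightarrow>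
    b = bracket3 u z - bracket2 u z * u (fst z) $ 2
        - u (fst z) $ 5 * (bracket1 u z - bracket2 u z * u (fst z) $ 4) \<and>
      m z = snd z * b - bracket2 u z \<and>
      a = bracket1 u z - bracket2 u z * u (fst z) $ 4 + 2/3 * snd z * m z - (snd z)^2/3 * b \<and>
      n z = - (snd z * a)"
    unfolding bracket_eq_iff[symmetric, where P = "u (fst z) $ 1" and Q = "u (fst z) $ 3"]
      vec_eq_iff_4 vector_add_component vector_scaleR_component lie_bracket_Lax[OF m n]
      K_field_nth R_field_nth
    by simp
  then show ?thesis
    unfolding lax_n_def lax_a_def lax_m_def lax_b_def by auto
qed

text \<open>\<open>d_lambda\<close> absorbs any last component, so only the horizontal part is
  constrained.\<close>

lemma in_span_Lax_iff:
  "w \<in> span {L0 u m z, L1 u n z, d_lambda} \<longleftrightarrow>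
    (\<exists>a b. fst w = a *\<^sub>R K_field u (snd z) (fst z) + b *\<^sub>R R_field u (snd z) (fst z))"
proof -
  have "w \<in> span {L0 u m z, L1 u n z, d_lambda} \<longleftrightarrow>
      (\<exists>a b c. w - a *\<^sub>R L0 u m z - b *\<^sub>R L1 u n z = c *\<^sub>R d_lambda)"
    unfolding span_breakdown_eq span_singleton by auto
  also have "\<dots> \<longleftrightarrow> (\<exists>a b. fst w = a *\<^sub>R K_field u (snd z) (fst z) + b *\<^sub>R R_field u (snd z) (fst z))"
  proof
    assume "\<exists>a b. fst w = a *\<^sub>R K_field u (snd z) (fst z) + b *\<^sub>R R_field u (snd z) (fst z)"
    then obtain a b where "fst w = a *\<^sub>R K_field u (snd z) (fst z) + b *\<^sub>R R_field u (snd z) (fst z)"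
      by blast
    then have "w - a *\<^sub>R L0 u m z - b *\<^sub>R L1 u n z = (snd w - a * m z - b * n z) *\<^sub>R d_lambda"
      by (simp add: prod_eq_iff L0_def L1_def d_lambda_def)
    then show "\<exists>a b c. w - a *\<^sub>R L0 u m z - b *\<^sub>R L1 u n z = c *\<^sub>R d_lambda"
      by blast
  qed (auto simp: prod_eq_iff L0_def L1_def d_lambda_def algebra_simps)
  finally show ?thesis .
qed

end

section \<open>Expansion of the Lax data along \<open>t v\<close> to first order in
  \<open>t\<close>\<close>

lemma poly_family_component: "smooth_map u \<Longrightarrow> poly_family (\<lambda>t z. u (fst z) $ i)"
  using poly_family.smooth[OF smooth_map_nth] .

text \<open>\<open>K\<close> is affine in the unknowns; this isolates the \<open>t\<close>-free part
  of the direction of differentiation.\<close>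

lemma K_field_scale:
  "K_field (\<lambda>y. t *\<^sub>R v y) l x = K_field (\<lambda>y. 0) l x + t *\<^sub>R (K_field v l x - K_field (\<lambda>y. 0) l x)"
  by (simp add: vec_eq_iff_4 K_field_nth algebra_simps)

lemma R_field_scale:
  "R_field (\<lambda>y. t *\<^sub>R v y) l x = R_field (\<lambda>y. 0) l x + t *\<^sub>R (R_field v l x - R_field (\<lambda>y. 0) l x)"
  by (simp add: vec_eq_iff_4 R_field_nth algebra_simps)

lemma poly_family_K_field:
  assumes "smooth_map v"
  shows "poly_family (\<lambda>t z. K_field v (snd z) (fst z) $ i)"
proof -
  have "\<forall>i. poly_family (\<lambda>t z. K_field v (snd z) (fst z) $ i)"
    unfolding forall_4' K_field_nth
    using poly_family_component[OF assms] by (auto intro!: poly_family_intros)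
  then show ?thesis
    by blast
qed

lemma poly_family_R_field:
  assumes "smooth_map v"
  shows "poly_family (\<lambda>t z. R_field v (snd z) (fst z) $ i)"
proof -
  have "\<forall>i. poly_family (\<lambda>t z. R_field v (snd z) (fst z) $ i)"
    unfolding forall_4' R_field_nth
    using poly_family_component[OF assms] by (auto intro!: poly_family_intros)
  then show ?thesis
    by blast
qed

lemma poly_family_K_der: "smooth_map v \<Longrightarrow> smooth_fun f \<Longrightarrow> poly_family (\<lambda>t. K_der v f)"
  unfolding K_der_def
  by (intro poly_family_sum poly_family.mult poly_family_K_field
      poly_family.smooth[OF smooth_fun_pderivative]) auto

lemma poly_family_R_der: "smooth_map v \<Longrightarrow> smooth_fun f \<Longrightarrow> poly_family (\<lambda>t. R_der v f)"
  unfolding R_der_def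
  by (intro poly_family_sum poly_family.mult poly_family_R_field
      poly_family.smooth[OF smooth_fun_pderivative]) auto

text \<open>A Taylor expansion without constant term; the remainder is again a family, so it may be
  differentiated in \<open>z\<close> and in \<open>t\<close>.\<close>

definition first_order ::
  "(real \<Rightarrow> (real^4) \<times> real \<Rightarrow> real) \<Rightarrow> ((real^4) \<times> real \<Rightarrow> real) \<Rightarrow> bool" where
  "first_order F G \<longleftrightarrow> poly_family (\<lambda>t. G) \<and>
     (\<exists>H. poly_family H \<and> (\<forall>t z. F t z = t * G z + t^2 * H t z))"

lemma first_orderI:
  assumes "poly_family (\<lambda>t. G)" "poly_family H" "\<And>t z. F t z = t * G z + t^2 * H t z"
  shows "first_order F G"
  using assms unfolding first_order_def by blast

lemma first_orderE:
  assumes "first_order F G"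
  obtains H where "poly_family (\<lambda>t. G)" "poly_family H" "F = (\<lambda>t z. t * G z + t^2 * H t z)"
  using assms unfolding first_order_def by (auto simp: fun_eq_iff)

lemma first_order_poly_family: "first_order F G \<Longrightarrow> poly_family F"
  by (elim first_orderE) (auto intro!: poly_family_intros)

lemma first_order_add:
  assumes "first_order F G" "first_order F' G'"
  shows "first_order (\<lambda>t z. F t z + F' t z) (\<lambda>z. G z + G' z)"
proof -
  obtain H where H: "poly_family (\<lambda>t. G)" "poly_family H" "F = (\<lambda>t z. t * G z + t^2 * H t z)"
    using assms(1) by (rule first_orderE)
  obtain H' where H': "poly_family (\<lambda>t. G')" "poly_family H'" "F' = (\<lambda>t z. t * G' z + t^2 * H' t z)"
    using assms(2) by (rule first_orderE)
  show ?thesis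
    by (rule first_orderI[of _ "\<lambda>t z. H t z + H' t z"])
      (use H H' in \<open>auto intro!: poly_family_intros simp: algebra_simps\<close>)
qed

lemma first_order_mult:
  assumes "poly_family (\<lambda>t. A)" "first_order F G"
  shows "first_order (\<lambda>t z. A z * F t z) (\<lambda>z. A z * G z)"
proof -
  obtain H where H: "poly_family (\<lambda>t. G)" "poly_family H" "F = (\<lambda>t z. t * G z + t^2 * H t z)"
    using assms(2) by (rule first_orderE)
  show ?thesis
    by (rule first_orderI[of _ "\<lambda>t z. A z * H t z"])
      (use H assms in \<open>auto intro!: poly_family_intros simp: algebra_simps\<close>)
qed

lemma first_order_minus: "first_order F G \<Longrightarrow> first_order (\<lambda>t z. - F t z) (\<lambda>z. - G z)"
  using first_order_mult[of "\<lambda>z. -1"] poly_family_const by simp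

lemma first_order_diff:
  assumes "first_order F G" "first_order F' G'"
  shows "first_order (\<lambda>t z. F t z - F' t z) (\<lambda>z. G z - G' z)"
  using first_order_add[OF assms(1) first_order_minus[OF assms(2)]] by simp

lemma first_order_prod:
  assumes "first_order F G" "first_order F' G'"
  shows "first_order (\<lambda>t z. F t z * F' t z) (\<lambda>z. 0)"
proof -
  obtain H where H: "poly_family (\<lambda>t. G)" "poly_family H" "F = (\<lambda>t z. t * G z + t^2 * H t z)"
    using assms(1) by (rule first_orderE)
  obtain H' where H': "poly_family (\<lambda>t. G')" "poly_family H'" "F' = (\<lambda>t z. t * G' z + t^2 * H' t z)"
    using assms(2) by (rule first_orderE)
  show ?thesis
    by (rule first_orderI[of _ "\<lambda>t z. (G z + t * H t z) * (G' z + t * H' t z)"])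
      (use H H' in \<open>auto intro!: poly_family_intros simp: algebra_simps power2_eq_square\<close>)
qed

text \<open>The differentiated function is already \<open>O(t)\<close>, so changes of order
  \<open>t\<close> in the direction, including its whole \<open>\<lambda>\<close>-component, only
  contribute \<open>O(t^2)\<close>.\<close>

lemma first_order_frechet_derivative:
  assumes F: "first_order F G" and s: "first_order s s0"
    and W0: "\<And>i. poly_family (\<lambda>t z. W0 z $ i)" and W1: "\<And>i. poly_family (\<lambda>t z. W1 t z $ i)"
    and W: "\<And>t z. W t z = W0 z + t *\<^sub>R W1 t z"
  shows "first_order (\<lambda>t z. frechet_derivative (F t) (at z) (W t z, s t z))
     (\<lambda>z. frechet_derivative G (at z) (W0 z, 0))"
proof -
  obtain H where G: "poly_family (\<lambda>t. G)" and H: "poly_family H"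
    and F_eq: "F = (\<lambda>t z. t * G z + t^2 * H t z)"
    using F by (rule first_orderE)
  obtain h where s0: "poly_family (\<lambda>t. s0)" and h: "poly_family h"
    and s_eq: "s = (\<lambda>t z. t * s0 z + t^2 * h t z)"
    using s by (rule first_orderE)
  have dG: "(G has_derivative frechet_derivative G (at z)) (at z)" for z
    using poly_family_differentiable[OF G] frechet_derivative_works by blast
  have dH: "(H t has_derivative frechet_derivative (H t) (at z)) (at z)" for t z
    using poly_family_differentiable[OF H] frechet_derivative_works by blast
  have "(F t has_derivative (\<lambda>w. t * frechet_derivative G (at z) w
      + t^2 * frechet_derivative (H t) (at z) w)) (at z)" for t z
    unfolding F_eq by (auto intro!: derivative_eq_intros dG dH)
  then have dF: "frechet_derivative (F t) (at z) = (\<lambda>w. t * frechet_derivative G (at z) w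
      + t^2 * frechet_derivative (H t) (at z) w)" for t z
    by (rule frechet_derivative_at[symmetric])
  have lin: "frechet_derivative G (at z) (W t z, s t z) = frechet_derivative G (at z) (W0 z, 0)
      + t * frechet_derivative G (at z) (W1 t z, s0 z + t * h t z)" for t z
  proof -
    interpret linear "frechet_derivative G (at z)"
      using dG by (rule has_derivative_linear)
    have "(W t z, s t z) = (W0 z, 0) + t *\<^sub>R (W1 t z, s0 z + t * h t z)"
      by (simp add: W s_eq algebra_simps power2_eq_square)
    then show ?thesis
      by (simp only: add scale) simp
  qed
  have W': "poly_family (\<lambda>t z. W t z $ i)" for i
    unfolding W by (simp, intro poly_family_intros W0 W1)
  show ?thesis
  proof (rule first_orderI)
    show "poly_family (\<lambda>t z. frechet_derivative G (at z) (W0 z, 0))"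
      by (rule poly_family_frechet_derivative[OF G]) (intro W0 poly_family_const)+
    show "poly_family (\<lambda>t z. frechet_derivative G (at z) (W1 t z, s0 z + t * h t z)
      + frechet_derivative (H t) (at z) (W t z, s t z))"
      by (intro poly_family.add poly_family_frechet_derivative G H W1 W' poly_family.mult
          poly_family.param s0 h first_order_poly_family[OF s])
  qed (simp add: dF lin algebra_simps power2_eq_square)
qed

lemma poly_family_has_real_derivative:
  assumes "poly_family H"
  shows "\<exists>d. ((\<lambda>t. H t z) has_real_derivative d) (at t)"
proof -
  obtain x l where z: "z = (x, l)"
    by fastforce
  obtain B where "\<And>t l. H t (x, l) = poly (poly B [:t:]) l"
    using poly_family_poly[OF assms] by blast
  then show ?thesis
    using has_real_derivative_poly_poly[of B l t] z by auto
qed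

lemma first_order_has_real_derivative:
  assumes "first_order F G"
  shows "((\<lambda>t. F t z) has_real_derivative G z) (at 0)"
proof -
  obtain H where H: "poly_family H" and F: "F = (\<lambda>t z. t * G z + t^2 * H t z)"
    using assms by (rule first_orderE)
  obtain d where "((\<lambda>t. H t z) has_real_derivative d) (at 0)"
    using poly_family_has_real_derivative[OF H] by blast
  then show ?thesis
    unfolding F by (auto intro!: derivative_eq_intros)
qed

text \<open>The linear part of \<open>lax_m\<close>: the two terms with \<open>R_der\<close> of
  component 5, from \<open>snd z * lax_b\<close> and from \<open>bracket2\<close>, have
  cancelled.\<close>

definition linear_m :: "(real^4 \<Rightarrow> real^5) \<Rightarrow> (real^4) \<times> real \<Rightarrow> real" where
  "linear_m v z = - ((snd z)^2 * R_der (\<lambda>x. 0) (\<lambda>x. v x $ 1) z)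
     + (snd z)^2 * K_der (\<lambda>x. 0) (\<lambda>x. v x $ 2) z + (snd z)^3 / 3 * K_der (\<lambda>x. 0) (\<lambda>x. v x $ 5) z"

definition linear_n :: "(real^4 \<Rightarrow> real^5) \<Rightarrow> (real^4) \<times> real \<Rightarrow> real" where
  "linear_n v z = (snd z)^4 / 3 * R_der (\<lambda>x. 0) (\<lambda>x. v x $ 1) z
     - (snd z)^4 / 3 * K_der (\<lambda>x. 0) (\<lambda>x. v x $ 2) z
     + (snd z)^2 * R_der (\<lambda>x. 0) (\<lambda>x. v x $ 3) z
     - (snd z)^2 * K_der (\<lambda>x. 0) (\<lambda>x. v x $ 4) z
     - (snd z)^3 / 3 * R_der (\<lambda>x. 0) (\<lambda>x. v x $ 5) z
     - (snd z)^5 / 9 * K_der (\<lambda>x. 0) (\<lambda>x. v x $ 5) z"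

definition linear_c :: "(real^4 \<Rightarrow> real^5) \<Rightarrow> (real^4) \<times> real \<Rightarrow> real" where
  "linear_c v z =
     frechet_derivative (linear_n v) (at z) (K_field (\<lambda>x. 0) (snd z) (fst z), 0)
     - frechet_derivative (linear_m v) (at z) (R_field (\<lambda>x. 0) (snd z) (fst z), 0)"

text \<open>The composition rules produce linear parts in raw form; this exchanges them for
  simplified ones.\<close>

lemma first_order_cong:
  assumes "first_order F G" "\<And>z. G z = G' z"
  shows "first_order F G'"
proof -
  have "G = G'"
    using assms(2) by (rule ext)
  then show ?thesis
    using assms(1) by simp
qed

context
  fixes v :: "real^4 \<Rightarrow> real^5"
  assumes v: "smooth_map v"
begin

lemma first_order_component:
  "first_order (\<lambda>t z. (t *\<^sub>R v (fst z)) $ i) (\<lambda>z. v (fst z) $ i)"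
  by (rule first_orderI[of _ "\<lambda>t z. 0"]) (auto intro!: poly_family_component v poly_family_const)

lemma pderivative_scaleR_component:
  "pderivative j (\<lambda>y. (t *\<^sub>R v y) $ i) = (\<lambda>x. t * pderivative j (\<lambda>y. v y $ i) x)"
  using pderivative_scale smooth_fun_differentiable[OF smooth_map_nth[OF v]] by simp

lemma first_order_K_der:
  "first_order (\<lambda>t. K_der (\<lambda>y. t *\<^sub>R v y) (\<lambda>y. (t *\<^sub>R v y) $ i)) (K_der (\<lambda>y. 0) (\<lambda>y. v y $ i))"
proof (rule first_orderI)
  show "K_der (\<lambda>y. t *\<^sub>R v y) (\<lambda>y. (t *\<^sub>R v y) $ i) z = t * K_der (\<lambda>y. 0) (\<lambda>y. v y $ i) z
      + t^2 * (K_der v (\<lambda>y. v y $ i) z - K_der (\<lambda>y. 0) (\<lambda>y. v y $ i) z)" for t z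
    unfolding K_der_def pderivative_scaleR_component K_field_scale
    by (simp add: sum_distrib_left sum_subtractf[symmetric] sum.distrib[symmetric]
        algebra_simps power2_eq_square)
qed (intro poly_family_diff poly_family_K_der smooth_map_const smooth_map_nth v)+

lemma first_order_R_der:
  "first_order (\<lambda>t. R_der (\<lambda>y. t *\<^sub>R v y) (\<lambda>y. (t *\<^sub>R v y) $ i)) (R_der (\<lambda>y. 0) (\<lambda>y. v y $ i))"
proof (rule first_orderI)
  show "R_der (\<lambda>y. t *\<^sub>R v y) (\<lambda>y. (t *\<^sub>R v y) $ i) z = t * R_der (\<lambda>y. 0) (\<lambda>y. v y $ i) z
      + t^2 * (R_der v (\<lambda>y. v y $ i) z - R_der (\<lambda>y. 0) (\<lambda>y. v y $ i) z)" for t z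
    unfolding R_der_def pderivative_scaleR_component R_field_scale
    by (simp add: sum_distrib_left sum_subtractf[symmetric] sum.distrib[symmetric]
        algebra_simps power2_eq_square)
qed (intro poly_family_diff poly_family_R_der smooth_map_const smooth_map_nth v)+

lemma first_order_bracket1:
  "first_order (\<lambda>t. bracket1 (\<lambda>y. t *\<^sub>R v y))
     (\<lambda>z. snd z * (K_der (\<lambda>x. 0) (\<lambda>x. v x $ 4) z - R_der (\<lambda>x. 0) (\<lambda>x. v x $ 3) z))"
  unfolding bracket1_def
  by (intro first_order_mult first_order_diff first_order_K_der first_order_R_der poly_family.snd)

lemma first_order_bracket2:
  "first_order (\<lambda>t. bracket2 (\<lambda>y. t *\<^sub>R v y)) (\<lambda>z. - (snd z * R_der (\<lambda>x. 0) (\<lambda>x. v x $ 5) z))"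
  unfolding bracket2_def
  by (intro first_order_minus first_order_mult first_order_R_der poly_family.snd)

lemma first_order_bracket3:
  "first_order (\<lambda>t. bracket3 (\<lambda>y. t *\<^sub>R v y)) (\<lambda>z. snd z * K_der (\<lambda>x. 0) (\<lambda>x. v x $ 2) z
     + (snd z)^2 / 3 * K_der (\<lambda>x. 0) (\<lambda>x. v x $ 5) z - R_der (\<lambda>x. 0) (\<lambda>x. v x $ 5) z
     - snd z * R_der (\<lambda>x. 0) (\<lambda>x. v x $ 1) z)"
  unfolding bracket3_def
  by (intro first_order_add first_order_diff first_order_mult first_order_K_der first_order_R_der
      poly_family_intros)

lemma first_order_lax_b:
  "first_order (\<lambda>t. lax_b (\<lambda>y. t *\<^sub>R v y)) (\<lambda>z. snd z * K_der (\<lambda>x. 0) (\<lambda>x. v x $ 2) z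
     + (snd z)^2 / 3 * K_der (\<lambda>x. 0) (\<lambda>x. v x $ 5) z - R_der (\<lambda>x. 0) (\<lambda>x. v x $ 5) z
     - snd z * R_der (\<lambda>x. 0) (\<lambda>x. v x $ 1) z)"
  unfolding lax_b_def
  by (rule first_order_cong, (rule first_order_diff first_order_prod first_order_component
      first_order_bracket1 first_order_bracket2 first_order_bracket3)+) simp

lemma first_order_lax_m: "first_order (\<lambda>t. lax_m (\<lambda>y. t *\<^sub>R v y)) (linear_m v)"
  unfolding lax_m_def
  by (rule first_order_cong, (rule first_order_diff first_order_mult poly_family.snd
      first_order_bracket2 first_order_lax_b)+)
    (simp add: linear_m_def algebra_simps power2_eq_square power3_eq_cube)

text \<open>The linear part is kept as the rules generate it; \<open>- 0\<close> stems from the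
  quadratic term \<open>bracket2 * T\<close>.\<close>

lemma first_order_lax_a:
  "first_order (\<lambda>t. lax_a (\<lambda>y. t *\<^sub>R v y)) (\<lambda>z.
     snd z * (K_der (\<lambda>x. 0) (\<lambda>x. v x $ 4) z - R_der (\<lambda>x. 0) (\<lambda>x. v x $ 3) z) - 0
     + 2/3 * snd z * linear_m v z - (snd z)^2 / 3 * (snd z * K_der (\<lambda>x. 0) (\<lambda>x. v x $ 2) z
       + (snd z)^2 / 3 * K_der (\<lambda>x. 0) (\<lambda>x. v x $ 5) z - R_der (\<lambda>x. 0) (\<lambda>x. v x $ 5) z
       - snd z * R_der (\<lambda>x. 0) (\<lambda>x. v x $ 1) z))"
  unfolding lax_a_def
  by (intro first_order_add first_order_diff first_order_bracket1
      first_order_prod[OF first_order_bracket2 first_order_component]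
      first_order_mult first_order_lax_b first_order_lax_m poly_family_intros)

lemma first_order_lax_n: "first_order (\<lambda>t. lax_n (\<lambda>y. t *\<^sub>R v y)) (linear_n v)"
  unfolding lax_n_def
  by (rule first_order_cong, (rule first_order_minus first_order_mult poly_family.snd
      first_order_lax_a)+)
    (simp add: linear_m_def linear_n_def field_simps eval_nat_numeral)

text \<open>The products \<open>a m\<close> and \<open>b n\<close> are \<open>O(t^2)\<close>, so
  only the two directional derivatives survive.\<close>

lemma first_order_lax_c: "first_order (\<lambda>t. lax_c (\<lambda>y. t *\<^sub>R v y)) (linear_c v)"
proof -
  have K: "first_order (\<lambda>t z. frechet_derivative (lax_n (\<lambda>y. t *\<^sub>R v y)) (at z)
        (K_field (\<lambda>y. t *\<^sub>R v y) (snd z) (fst z), lax_m (\<lambda>y. t *\<^sub>R v y) z))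
      (\<lambda>z. frechet_derivative (linear_n v) (at z) (K_field (\<lambda>y. 0) (snd z) (fst z), 0))"
    by (rule first_order_frechet_derivative[OF first_order_lax_n first_order_lax_m _ _ K_field_scale])
      (auto intro!: poly_family_diff poly_family_K_field v smooth_map_const)
  have R: "first_order (\<lambda>t z. frechet_derivative (lax_m (\<lambda>y. t *\<^sub>R v y)) (at z)
        (R_field (\<lambda>y. t *\<^sub>R v y) (snd z) (fst z), lax_n (\<lambda>y. t *\<^sub>R v y) z))
      (\<lambda>z. frechet_derivative (linear_m v) (at z) (R_field (\<lambda>y. 0) (snd z) (fst z), 0))"
    by (rule first_order_frechet_derivative[OF first_order_lax_m first_order_lax_n _ _ R_field_scale])
      (auto intro!: poly_family_diff poly_family_R_field v smooth_map_const)
  show ?thesis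
    unfolding lax_c_def
    by (rule first_order_cong, (rule first_order_diff K R first_order_prod first_order_lax_a
        first_order_lax_b first_order_lax_m first_order_lax_n)+) (simp add: linear_c_def)
qed

end

section \<open>Uniqueness of the normalized Lax pair and the resulting PDE system\<close>

lemma poly_family_lax:
  assumes v: "smooth_map v"
  shows "poly_family (\<lambda>t. lax_m (\<lambda>y. t *\<^sub>R v y))" "poly_family (\<lambda>t. lax_n (\<lambda>y. t *\<^sub>R v y))"
    "poly_family (\<lambda>t. lax_c (\<lambda>y. t *\<^sub>R v y))"
  using first_order_poly_family first_order_lax_m first_order_lax_n first_order_lax_c v by blast+

lemma lax_mn_differentiable:
  assumes "smooth_map u"
  shows "lax_m u differentiable (at z)" "lax_n u differentiable (at z)"
  \<comment> \<open>\<open>u\<close> is the member \<open>t = 1\<close> of its own family.\<close>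
  using poly_family_differentiable[OF poly_family_lax(1)[OF assms], of 1]
    poly_family_differentiable[OF poly_family_lax(2)[OF assms], of 1] by simp_all

lemma lax_normalized_iff:
  assumes u: "smooth_map u"
  shows "lax_normalized u (m, n) \<longleftrightarrow> m = lax_m u \<and> n = lax_n u"
proof -
  have *: "lie_bracket (L0 u m) (L1 u n) z \<in> span {L0 u m z, L1 u n z, d_lambda} \<longleftrightarrow>
      m z = lax_m u z \<and> n z = lax_n u z"
    if "m differentiable (at z)" "n differentiable (at z)" for m n z
    unfolding in_span_Lax_iff[OF u] lie_bracket_Lax_horizontal_iff[OF u that] by blast
  show ?thesis
  proof
    assume "lax_normalized u (m, n)"
    then have "m z = lax_m u z \<and> n z = lax_n u z" for z
      using *[of m z n] unfolding lax_normalized_def differentiable_on_def by blast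
    then show "m = lax_m u \<and> n = lax_n u"
      by (simp add: fun_eq_iff)
  next
    assume "m = lax_m u \<and> n = lax_n u"
    then show "lax_normalized u (m, n)"
      using *[OF lax_mn_differentiable[OF u]] lax_mn_differentiable[OF u]
      unfolding lax_normalized_def differentiable_on_def by blast
  qed
qed

lemma ex1_lax_normalized: "smooth_map u \<Longrightarrow> \<exists>!mn. lax_normalized u mn"
  by (rule ex1I[of _ "(lax_m u, lax_n u)"]) (auto simp: lax_normalized_iff)

lemma lax_mn_eq: "smooth_map u \<Longrightarrow> lax_mn u = (lax_m u, lax_n u)"
  unfolding lax_mn_def by (rule the1_equality[OF ex1_lax_normalized]) (auto simp: lax_normalized_iff)

text \<open>Uniqueness of all three coefficients justifies the description in
  \<open>lax_component\<close>, and \<open>c = 0\<close> gives the half-flatness condition.\<close>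

lemma lie_bracket_lax_iff:
  assumes u: "smooth_map u"
  shows "lie_bracket (lax_L0 u) (lax_L1 u) z = a *\<^sub>R lax_L0 u z + b *\<^sub>R lax_L1 u z + c *\<^sub>R d_lambda \<longleftrightarrow>
    a = lax_a u z \<and> b = lax_b u z \<and> c = lax_c u z"
proof -
  note d = lax_mn_differentiable[OF u, of z]
  have "lie_bracket (lax_L0 u) (lax_L1 u) z = a *\<^sub>R lax_L0 u z + b *\<^sub>R lax_L1 u z + c *\<^sub>R d_lambda \<longleftrightarrow>
    fst (lie_bracket (L0 u (lax_m u)) (L1 u (lax_n u)) z) =
      a *\<^sub>R K_field u (snd z) (fst z) + b *\<^sub>R R_field u (snd z) (fst z) \<and>
    snd (lie_bracket (L0 u (lax_m u)) (L1 u (lax_n u)) z) = a * lax_m u z + b * lax_n u z + c"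
    by (simp add: lax_L0_def lax_L1_def lax_mn_eq[OF u] prod_eq_iff)
      (simp add: L0_def L1_def d_lambda_def)
  then show ?thesis
    unfolding lie_bracket_Lax_horizontal_iff[OF u d] lie_bracket_Lax(5)[OF u d] lax_c_def by auto
qed

lemma lax_component_eq: "smooth_map u \<Longrightarrow> lax_component u z = lax_c u z"
  unfolding lax_component_def lie_bracket_lax_iff by auto

lemma lax_condition_iff_lax_c:
  assumes u: "smooth_map u"
  shows "lax_condition u \<longleftrightarrow> (\<forall>z. lax_c u z = 0)"
proof -
  have "lie_bracket (lax_L0 u) (lax_L1 u) z \<in> span {lax_L0 u z, lax_L1 u z} \<longleftrightarrow>
      (\<exists>a b. lie_bracket (lax_L0 u) (lax_L1 u) z = a *\<^sub>R lax_L0 u z + b *\<^sub>R lax_L1 u z + 0 *\<^sub>R d_lambda)" for z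
    unfolding span_breakdown_eq span_singleton by (simp add: image_iff diff_eq_eq ac_simps)
  then show ?thesis
    unfolding lax_condition_def lie_bracket_lax_iff[OF u] by auto
qed

lemma lax_poly_eq:
  assumes "smooth_map u" and "\<And>l. lax_c u (x, l) = poly q l"
  shows "lax_poly u x = q"
  unfolding lax_poly_def lax_component_eq[OF assms(1)] assms(2)
  by (rule the_equality) (auto simp: poly_eq_poly_eq_iff[symmetric] fun_eq_iff)

lemma lax_condition_iff_lax_pde:
  assumes u: "smooth_map u"
  shows "lax_condition u \<longleftrightarrow> (\<forall>k x. lax_pde k u x = 0)"
proof -
  have "(\<forall>l. lax_c u (x, l) = 0) \<longleftrightarrow> (\<forall>k. lax_pde k u x = 0)" for x
  proof -
    obtain B where "\<And>t l. lax_c (\<lambda>y. t *\<^sub>R u y) (x, l) = poly (poly B [:t:]) l"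
      using poly_family_poly[OF poly_family_lax(3)[OF u]] by blast
    from this[of 1] have B: "lax_c u (x, l) = poly (poly B [:1:]) l" for l
      by simp
    show ?thesis
      unfolding lax_pde_def lax_poly_eq[OF u B] B poly_all_0_iff_0 by (simp add: poly_eq_iff)
  qed
  then show ?thesis
    unfolding lax_condition_iff_lax_c[OF u] by auto
qed

section \<open>The linearization\<close>

text \<open>The components of \<open>K\<close> along the trivial solution as polynomials in
  \<open>l\<close>; contracted with \<open>p\<close> they give \<open>k\<close>, as those of
  \<open>r_coeff\<close> give \<open>r\<close>.\<close>

definition k_coeff :: "4 \<Rightarrow> real poly" where
  "k_coeff i = (if i = 0 then [:0, 1:] else if i = 1 then 1 else 0)"

definition r_coeff :: "4 \<Rightarrow> real poly" where
  "r_coeff i = (if i = 0 then 0 else if i = 1 then [:0, 0, 1/3:] else if i = 2 then [:0, 1:] else 1)"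

lemma K_field_0: "K_field (\<lambda>x. 0) l x $ i = poly (k_coeff i) l"
proof -
  have "\<forall>i. K_field (\<lambda>x. 0) l x $ i = poly (k_coeff i) l"
    unfolding forall_4' K_field_nth by (simp add: k_coeff_def)
  then show ?thesis
    by blast
qed

lemma R_field_0: "R_field (\<lambda>x. 0) l x $ i = poly (r_coeff i) l"
proof -
  have "\<forall>i. R_field (\<lambda>x. 0) l x $ i = poly (r_coeff i) l"
    unfolding forall_4' R_field_nth by (simp add: r_coeff_def power2_eq_square)
  then show ?thesis
    by blast
qed

definition second_der ::
  "(4 \<Rightarrow> real poly) \<Rightarrow> (4 \<Rightarrow> real poly) \<Rightarrow> (real^4 \<Rightarrow> real) \<Rightarrow> real^4 \<Rightarrow> real \<Rightarrow> real" where
  "second_der A B f x l = (\<Sum>i\<in>UNIV. \<Sum>j\<in>UNIV.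
     poly (A i * B j) l * pderivative i (pderivative j f) x)"

lemma has_derivative_second_der:
  assumes f: "smooth_fun f"
  shows "((\<lambda>y. \<Sum>j\<in>UNIV. poly (B j) l * pderivative j f y) has_derivative
     (\<lambda>w. \<Sum>i\<in>UNIV. \<Sum>j\<in>UNIV. w $ i * poly (B j) l * pderivative i (pderivative j f) x)) (at x)"
proof -
  have "(pderivative j f has_derivative
      (\<lambda>w. \<Sum>i\<in>UNIV. w $ i * pderivative i (pderivative j f) x)) (at x)" for j
    by (intro has_derivative_pderivative smooth_fun_differentiable smooth_fun_pderivative f)
  then have "((\<lambda>y. \<Sum>j\<in>UNIV. poly (B j) l * pderivative j f y) has_derivative
      (\<lambda>w. \<Sum>j\<in>UNIV. poly (B j) l * (\<Sum>i\<in>UNIV. w $ i * pderivative i (pderivative j f) x))) (at x)"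
    by (auto intro!: derivative_eq_intros)
  then show ?thesis
    by (rule has_derivative_eq_rhs)
      (subst sum.swap, simp add: sum_distrib_left mult_ac)
qed

text \<open>In a horizontal direction \<open>l\<close> is constant, so the powers of
  \<open>l\<close> act as scalars when \<open>linear_m\<close> and \<open>linear_n\<close> are
  differentiated.\<close>

lemma frechet_derivative_fst:
  assumes G: "G differentiable (at (x, l))" and g: "((\<lambda>y. G (y, l)) has_derivative g) (at x)"
  shows "frechet_derivative G (at (x, l)) (w, 0) = g w"
proof -
  have "((\<lambda>y. (y, l)) has_derivative (\<lambda>w. (w, 0))) (at x)"
    by (auto intro!: derivative_eq_intros)
  moreover have "(G has_derivative frechet_derivative G (at (x, l))) (at (x, l))"
    using G frechet_derivative_works by blast
  ultimately have "((\<lambda>y. G (y, l)) has_derivative (\<lambda>w. frechet_derivative G (at (x, l)) (w, 0))) (at x)"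
    using has_derivative_compose[of "\<lambda>y. (y, l)" "\<lambda>w. (w, 0)" x UNIV G] by simp
  then show ?thesis
    using g has_derivative_unique by metis
qed

text \<open>The coefficients of \<open>K\<^sub>0 n\<^sub>1 - R\<^sub>0 m\<^sub>1\<close>, not
  symmetrized: \<open>j\<close> belongs to the outer derivative and \<open>m\<close> to the one
  inside \<open>n\<^sub>1\<close> or \<open>m\<^sub>1\<close>.\<close>

definition symbol_coeff :: "5 \<Rightarrow> 4 \<Rightarrow> 4 \<Rightarrow> real poly" where
  "symbol_coeff = (\<lambda>i j m.
     if i = 1 then monom (1/3) 4 * (k_coeff j * r_coeff m) + monom 1 2 * (r_coeff j * r_coeff m)
     else if i = 2 then - (monom (1/3) 4 * (k_coeff j * k_coeff m)) - monom 1 2 * (r_coeff j * k_coeff m)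
     else if i = 3 then monom 1 2 * (k_coeff j * r_coeff m)
     else if i = 4 then - (monom 1 2 * (k_coeff j * k_coeff m))
     else - (monom (1/3) 3 * (k_coeff j * r_coeff m)) - monom (1/9) 5 * (k_coeff j * k_coeff m)
       - monom (1/3) 3 * (r_coeff j * k_coeff m))"

text \<open>For fixed \<open>l\<close> the fields \<open>K\<^sub>0\<close> and
  \<open>R\<^sub>0\<close> have constant coefficients, so their compositions are purely of second
  order.\<close>

lemma linear_c_eq:
  assumes v: "smooth_map v"
  shows "linear_c v (x, l) = (\<Sum>i\<in>UNIV. \<Sum>j\<in>UNIV. \<Sum>m\<in>UNIV.
     poly (symbol_coeff i j m) l * pderivative j (pderivative m (\<lambda>y. v y $ i)) x)"
proof -
  define S where "S = (\<lambda>B i y. \<Sum>j\<in>UNIV. poly (B j) l * pderivative j (\<lambda>y. v y $ i) y)"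
  have K: "K_der (\<lambda>x. 0) (\<lambda>x. v x $ i) (y, l) = S k_coeff i y" for i y
    by (simp add: S_def K_der_def K_field_0)
  have R: "R_der (\<lambda>x. 0) (\<lambda>x. v x $ i) (y, l) = S r_coeff i y" for i y
    by (simp add: S_def R_der_def R_field_0)
  define dd where "dd = (\<lambda>B i w. \<Sum>j\<in>UNIV. \<Sum>m\<in>UNIV.
    w $ j * poly (B m) l * pderivative j (pderivative m (\<lambda>y. v y $ i)) x)"
  have der: "(S B i has_derivative dd B i) (at x)" for B i
    unfolding S_def dd_def using has_derivative_second_der[OF smooth_map_nth[OF v]] .
  have m: "frechet_derivative (linear_m v) (at (x, l)) (w, 0) =
      - (l^2 * dd r_coeff 1 w) + l^2 * dd k_coeff 2 w + l^3 / 3 * dd k_coeff 5 w" for w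
  proof (rule frechet_derivative_fst)
    show "linear_m v differentiable (at (x, l))"
      using first_order_lax_m[OF v] by (auto elim: first_orderE intro: poly_family_differentiable)
    show "((\<lambda>y. linear_m v (y, l)) has_derivative (\<lambda>w. - (l^2 * dd r_coeff 1 w)
        + l^2 * dd k_coeff 2 w + l^3 / 3 * dd k_coeff 5 w)) (at x)"
      unfolding linear_m_def K R snd_conv by (auto intro!: derivative_eq_intros der)
  qed
  have n: "frechet_derivative (linear_n v) (at (x, l)) (w, 0) =
      l^4 / 3 * dd r_coeff 1 w - l^4 / 3 * dd k_coeff 2 w + l^2 * dd r_coeff 3 w
      - l^2 * dd k_coeff 4 w - l^3 / 3 * dd r_coeff 5 w - l^5 / 9 * dd k_coeff 5 w" for w
  proof (rule frechet_derivative_fst)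
    show "linear_n v differentiable (at (x, l))"
      using first_order_lax_n[OF v] by (auto elim: first_orderE intro: poly_family_differentiable)
    show "((\<lambda>y. linear_n v (y, l)) has_derivative (\<lambda>w.
        l^4 / 3 * dd r_coeff 1 w - l^4 / 3 * dd k_coeff 2 w + l^2 * dd r_coeff 3 w
        - l^2 * dd k_coeff 4 w - l^3 / 3 * dd r_coeff 5 w - l^5 / 9 * dd k_coeff 5 w)) (at x)"
      unfolding linear_n_def K R snd_conv by (auto intro!: derivative_eq_intros der)
  qed
  have dK: "dd B i (K_field (\<lambda>x. 0) l x) = second_der k_coeff B (\<lambda>y. v y $ i) x l" for B i
    by (simp add: dd_def second_der_def K_field_0)
  have dR: "dd B i (R_field (\<lambda>x. 0) l x) = second_der r_coeff B (\<lambda>y. v y $ i) x l" for B i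
    by (simp add: dd_def second_der_def R_field_0)
  show ?thesis
    unfolding linear_c_def fst_conv snd_conv m n dK dR second_der_def sum_5
    by (simp add: symbol_coeff_def poly_monom algebra_simps sum.distrib sum_subtractf sum_negf
        sum_distrib_left)
qed

lemma has_real_derivative_lax_pde:
  assumes v: "smooth_map v"
  shows "((\<lambda>t. lax_pde k (\<lambda>y. 0 + t *\<^sub>R v y) x) has_real_derivative
     (\<Sum>i\<in>UNIV. \<Sum>j\<in>UNIV. \<Sum>m\<in>UNIV.
       coeff (symbol_coeff i j m) k * pderivative j (pderivative m (\<lambda>y. v y $ i)) x)) (at 0)"
proof -
  obtain B where B: "\<And>t l. lax_c (\<lambda>y. t *\<^sub>R v y) (x, l) = poly (poly B [:t:]) l"
    using poly_family_poly[OF poly_family_lax(3)[OF v]] by blast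
  define q where "q = (\<Sum>i\<in>UNIV. \<Sum>j\<in>UNIV. \<Sum>m\<in>UNIV.
    smult (pderivative j (pderivative m (\<lambda>y. v y $ i)) x) (symbol_coeff i j m))"
  \<comment> \<open>Both sides are the derivative of \<open>lax_c\<close> at \<open>t = 0\<close>;
    equality for all \<open>l\<close> identifies the polynomials, hence their coefficients.\<close>
  have "poly (poly (pderiv B) [:0:]) l = poly q l" for l
  proof (rule DERIV_unique)
    show "((\<lambda>t. poly (poly B [:t:]) l) has_real_derivative poly (poly (pderiv B) [:0:]) l) (at 0)"
      by (rule has_real_derivative_poly_poly)
    show "((\<lambda>t. poly (poly B [:t:]) l) has_real_derivative poly q l) (at 0)"
      using first_order_has_real_derivative[OF first_order_lax_c[OF v], of "(x, l)"]
      by (simp add: B linear_c_eq[OF v] q_def poly_sum mult.commute)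
  qed
  then have "poly (pderiv B) [:0:] = q"
    by (simp add: poly_eq_poly_eq_iff[symmetric] fun_eq_iff)
  moreover have "lax_pde k (\<lambda>y. 0 + t *\<^sub>R v y) x = coeff (poly B [:t:]) k" for t
    using lax_poly_eq[OF smooth_map_scaleR[OF v] B] by (simp add: lax_pde_def)
  ultimately show ?thesis
    using has_real_derivative_coeff_poly[of B k 0] by (simp add: q_def coeff_sum mult.commute)
qed

lemma linearized_symbol_lax_pde:
  "linearized_symbol (lax_pde k) (\<lambda>x. 0) (\<lambda>x p. \<chi> i.
     coeff (\<Sum>j\<in>UNIV. \<Sum>m\<in>UNIV. smult (p $ j * p $ m) (symbol_coeff i j m)) k)"
  unfolding linearized_symbol_def
proof (intro exI conjI)
  show "is_linearization (lax_pde k) (\<lambda>x. 0) (\<lambda>v x. \<Sum>i\<in>UNIV. \<Sum>j\<in>UNIV. \<Sum>m\<in>UNIV.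
      coeff (symbol_coeff i j m) k * pderivative j (pderivative m (\<lambda>y. v y $ i)) x)"
    unfolding is_linearization_def using has_real_derivative_lax_pde by blast
  \<comment> \<open>The linearization has no lower order terms, so \<open>b\<close> and
    \<open>c\<close> are zero.\<close>
  show "has_second_order_symbol (\<lambda>v x. \<Sum>i\<in>UNIV. \<Sum>j\<in>UNIV. \<Sum>m\<in>UNIV.
      coeff (symbol_coeff i j m) k * pderivative j (pderivative m (\<lambda>y. v y $ i)) x)
      (\<lambda>x p. \<chi> i. coeff (\<Sum>j\<in>UNIV. \<Sum>m\<in>UNIV. smult (p $ j * p $ m) (symbol_coeff i j m)) k)"
    unfolding has_second_order_symbol_def
    by (rule exI[of _ "\<lambda>x i j m. coeff (symbol_coeff i j m) k"], rule exI[of _ "\<lambda>x i j. 0"],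
        rule exI[of _ "\<lambda>x i. 0"]) (simp add: coeff_sum mult_ac)
qed

section \<open>Comparison of the symbol with the matrix\<close>

definition symbol_poly :: "real^4 \<Rightarrow> 5 \<Rightarrow> real poly" where
  "symbol_poly p i = (let k = [:p$1, p$0:]; r = [:p$3, p$2, p$1 / 3:] in
     if i = 1 then monom (1/3) 4 * (k * r) + monom 1 2 * (r * r)
     else if i = 2 then - (monom (1/3) 4 * (k * k)) - monom 1 2 * (r * k)
     else if i = 3 then monom 1 2 * (k * r)
     else if i = 4 then - (monom 1 2 * (k * k))
     else - (monom (1/3) 3 * (k * r)) - monom (1/9) 5 * (k * k) - monom (1/3) 3 * (r * k))"

text \<open>By bilinearity each double sum factors into a product of two of the polynomials
  \<open>k\<close> and \<open>r\<close>.\<close>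

lemma symbol_poly_eq:
  "(\<Sum>j\<in>UNIV. \<Sum>m\<in>UNIV. smult (p $ j * p $ m) (symbol_coeff i j m)) = symbol_poly p i"
proof -
  have k: "[:p$1, p$0:] = (\<Sum>j\<in>UNIV. smult (p $ j) (k_coeff j))"
    by (simp add: sum_4' k_coeff_def)
  have r: "[:p$3, p$2, p$1 / 3:] = (\<Sum>j\<in>UNIV. smult (p $ j) (r_coeff j))"
    by (simp add: sum_4' r_coeff_def)
  have prod: "(\<Sum>j\<in>UNIV. smult (p $ j) (A j)) * (\<Sum>m\<in>UNIV. smult (p $ m) (B m)) =
      (\<Sum>j\<in>UNIV. \<Sum>m\<in>UNIV. smult (p $ j * p $ m) (A j * B m))" for A B :: "4 \<Rightarrow> real poly"
    by (simp add: sum_product mult_ac)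
  show ?thesis
    unfolding symbol_poly_def Let_def k r prod symbol_coeff_def
    by (simp add: sum_distrib_left sum.distrib sum_subtractf sum_negf smult_add_right
        smult_diff_right)
qed

lemma lax_symbol_matrix_nth:
  "lax_symbol_matrix p $ 1 = vector [(p$3)^2, 2 * p$2 * p$3, p$1 * p$3 + (p$2)^2,
     p$1 * p$2 + 1/3 * p$0 * p$3, 2/9 * (p$1)^2 + 1/3 * p$0 * p$2, 1/9 * p$0 * p$1]"
  "lax_symbol_matrix p $ 2 = vector [- (p$1 * p$3), - (p$0 * p$3 + p$1 * p$2),
     - (p$0 * p$2 + 2/3 * (p$1)^2), - (p$0 * p$1), - (1/3 * (p$0)^2), 0]"
  "lax_symbol_matrix p $ 3 = vector [p$1 * p$3, p$0 * p$3 + p$1 * p$2, p$0 * p$2 + 1/3 * (p$1)^2,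
     1/3 * p$0 * p$1, 0, 0]"
  "lax_symbol_matrix p $ 4 = vector [- ((p$1)^2), - (2 * p$0 * p$1), - ((p$0)^2), 0, 0, 0]"
  "lax_symbol_matrix p $ 5 = vector [0, - (2/3 * p$1 * p$3), - (2/3 * p$0 * p$3 + 2/3 * p$1 * p$2),
     - (2/3 * p$0 * p$2 + 1/3 * (p$1)^2), - (4/9 * p$0 * p$1), - (1/9 * (p$0)^2)]"
  by (simp_all add: vec_eq_iff forall_6 lax_symbol_matrix_def row_sign_def cayley_symbol_def Let_def
      vector_5 vector_6)

text \<open>The two leading zeros are the common factor \<open>l^2\<close>; because of them column
  \<open>j\<close> is the coefficient of \<open>l^(j + 1)\<close>.\<close>

lemma symbol_poly_lax_symbol_matrix:
  "symbol_poly p i = (let s = lax_symbol_matrix p $ i in [:0, 0, s$1, s$2, s$3, s$4, s$5, s$6:])"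
proof -
  let ?k = "[:p$1, p$0:]" and ?r = "[:p$3, p$2, p$1 / 3:]"
  have kr: "?k * ?r = [:p$1 * p$3, p$0 * p$3 + p$1 * p$2, p$0 * p$2 + p$1 * p$1 / 3, p$0 * p$1 / 3:]"
    by (simp add: algebra_simps)
  have rk: "?r * ?k = ?k * ?r"
    by (rule mult.commute)
  have kk: "?k * ?k = [:p$1 * p$1, 2 * p$0 * p$1, p$0 * p$0:]"
    by (simp add: algebra_simps)
  have rr: "?r * ?r = [:p$3 * p$3, 2 * p$2 * p$3, p$2 * p$2 + 2/3 * p$1 * p$3, 2/3 * p$1 * p$2,
      p$1 * p$1 / 9:]"
    by (simp add: algebra_simps)
  have "\<forall>i. symbol_poly p i =
      (let s = lax_symbol_matrix p $ i in [:0, 0, s$1, s$2, s$3, s$4, s$5, s$6:])"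
    unfolding forall_5 lax_symbol_matrix_nth symbol_poly_def Let_def vector_6 rk kr kk rr
    by (simp add: eval_nat_numeral monom_Suc monom_0 field_simps)
  then show ?thesis
    by blast
qed

lemma linearized_symbol_lax_pde_column:
  assumes "j \<in> {1..6::nat}"
  shows "linearized_symbol (lax_pde (j + 1)) (\<lambda>x. 0) (\<lambda>x p. column (of_nat j) (lax_symbol_matrix p))"
proof -
  have "j = 1 \<or> j = 2 \<or> j = 3 \<or> j = 4 \<or> j = 5 \<or> j = 6"
    using assms by auto
  then have "coeff (symbol_poly p i) (j + 1) = lax_symbol_matrix p $ i $ of_nat j" for p i
    unfolding symbol_poly_lax_symbol_matrix Let_def by (elim disjE) (simp_all add: eval_nat_numeral)
  then show ?thesis
    using linearized_symbol_lax_pde[of "j + 1"] by (simp add: symbol_poly_eq column_def)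
qed

lemma linearized_symbol_lax_pde_0:
  assumes "k \<notin> {2..7}"
  shows "linearized_symbol (lax_pde k) (\<lambda>x. 0) (\<lambda>x p. 0)"
proof -
  have "coeff (symbol_poly p i) k = 0" for p i
    using assms unfolding symbol_poly_lax_symbol_matrix Let_def
    by (auto simp: coeff_pCons split: nat.split)
  then show ?thesis
    using linearized_symbol_lax_pde[of k] by (simp add: symbol_poly_eq zero_vec_def)
qed

section \<open>The trivial solution and its flat coframe\<close>

lemma lax_condition_0: "lax_condition (\<lambda>x. 0)"
proof -
  have "K_der (\<lambda>x. 0) (\<lambda>x. 0) = (\<lambda>z. 0)" "R_der (\<lambda>x. 0) (\<lambda>x. 0) = (\<lambda>z. 0)"
    by (simp_all add: K_der_def R_der_def pderivative_const fun_eq_iff)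
  then have "lax_a (\<lambda>x. 0) = (\<lambda>z. 0)" "lax_b (\<lambda>x. 0) = (\<lambda>z. 0)" "lax_m (\<lambda>x. 0) = (\<lambda>z. 0)"
    "lax_n (\<lambda>x. 0) = (\<lambda>z. 0)"
    by (simp_all add: fun_eq_iff lax_n_def lax_a_def lax_m_def lax_b_def bracket1_def bracket2_def
        bracket3_def)
  then show ?thesis
    unfolding lax_condition_iff_lax_c[OF smooth_map_const] lax_c_def by simp
qed

lemma normal_form_unknowns_0: "normal_form_unknowns (\<lambda>x. 0) (\<lambda>x. 0) (\<lambda>x. 0) = (\<lambda>x. 0)"
  by (simp add: fun_eq_iff normal_form_unknowns_def pderivative_const vec_eq_iff forall_5 vector_5)

lemma normal_coframe_0: "normal_coframe (\<lambda>x. 0) (\<lambda>x. 0) (\<lambda>x. 0) = (\<lambda>x y. y)"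
  by (simp add: fun_eq_iff normal_coframe_def pderivative_const vec_eq_iff_4)

lemma cayley_structure_cayley_cubic: "cayley_structure (\<lambda>x y. cayley_cubic y)"
  unfolding cayley_structure_def is_coframe_def
  by (intro exI[of _ "\<lambda>x y. y"]) (simp add: smooth_map_const linear_ident)

theorem theorem7p6:
  shows
    "(\<forall>u. smooth_map u \<longrightarrow>
        (\<exists>!mn. lax_normalized u mn) \<and>
        (lax_condition u \<longleftrightarrow> (\<forall>k x. lax_pde k u x = 0))) \<and>
     lax_condition (\<lambda>x. 0) \<and>
     (\<forall>j\<in>{1..6::nat}. linearized_symbol (lax_pde (j + 1)) (\<lambda>x. 0)
        (\<lambda>x p. column (of_nat j) (lax_symbol_matrix p))) \<and>
     (\<forall>k. k \<notin> {2..7} \<longrightarrow> linearized_symbol (lax_pde k) (\<lambda>x. 0) (\<lambda>x p. 0)) \<and>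
     (\<forall>p. rank (lax_symbol_matrix p) = rank (cayley_symbol p)) \<and>
     (\<forall>p. p$0 \<noteq> 0 \<or> p$2 \<noteq> 0 \<longrightarrow> (rank (cayley_symbol p) \<le> 4 \<longleftrightarrow> dual_cubic p = 0)) \<and>
     (\<forall>p. p$0 = 0 \<and> p$2 = 0 \<longrightarrow> rank (cayley_symbol p) \<le> 4) \<and>
     {p. dual_cubic p = 0} = dual_variety cayley_cubic \<and>
     normal_form_unknowns (\<lambda>x. 0) (\<lambda>x. 0) (\<lambda>x. 0) = (\<lambda>x. 0) \<and>
     normal_coframe (\<lambda>x. 0) (\<lambda>x. 0) (\<lambda>x. 0) = (\<lambda>x y. y) \<and>
     cayley_structure (\<lambda>x y. cayley_cubic y)"
  using ex1_lax_normalized lax_condition_iff_lax_pde lax_condition_0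
    linearized_symbol_lax_pde_column linearized_symbol_lax_pde_0 rank_lax_symbol_matrix
    rank_cayley_symbol_iff rank_cayley_symbol_plane dual_cubic_eq_dual_variety
    normal_form_unknowns_0 normal_coframe_0 cayley_structure_cayley_cubic
  by (intro conjI allI impI ballI) auto

end
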